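(* Let $n\ge1$ and let $u\in C^1(\mathbb{R}^n)\cap C^3(\{x\in\mathbb{R}^n:|\nabla u(x)|>0\})$ be an entire solution of $$\operatorname{div}\left(\frac{\nabla u}{\sqrt{1+|\nabla u|^2}}\right)=f(\nabla u)\quad\text{in }\mathbb{R}^n.$$ Then $u$ must be constant in each of the following cases: (E1) $f(p)=|p|^\theta$ with $\theta>0$; (E2) $f(p)=\log^\theta(1+|p|^2)$ with $\theta>1$; (E3) $f(p)=\log^\theta(1+|p|^2)$ with $0<\theta\le1$, provided $u(x)=o(|x|^2)$ as $|x|\to\infty$; (E4) $f(p)=\dfrac{|p|}{\sqrt{1+|p|^2}}$, provided $u(x)=o(|x|^{1/3})$ as $|x|\to\infty$.
   Context: $\log^\theta(t)$ means $(\log t)^\theta$. At points where $\nabla u\ne0$, where $u$ is $C^3$, the equation is equivalent to $\sum_{i,j}\left(\delta^{ij}-\frac{u_iu_j}{1+|\nabla u|^2}\right)u_{ij}=(1+|\nabla u|^2)^{1/2}f(\nabla u)$, where subscripts on $u$ denote partial derivatives. The paper does not further specify the sense in which the equation holds at critical points of $u$. *)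

theory Defs
  imports "HOL-Analysis.Analysis" "HOL-Library.Landau_Symbols"
begin

text \<open>Intended for open sets \<open>S\<close>: the derivatives are full derivatives, not derivatives within \<open>S\<close>.\<close>

primrec C_k_on :: "nat \<Rightarrow> ('a::euclidean_space \<Rightarrow> 'b::real_normed_vector) \<Rightarrow> 'a set \<Rightarrow> bool" where
  "C_k_on 0 f S \<longleftrightarrow> continuous_on S f"
| "C_k_on (Suc k) f S \<longleftrightarrow>
     (\<forall>x\<in>S. f differentiable (at x)) \<and>
     (\<forall>v. C_k_on k (\<lambda>x. frechet_derivative f (at x) v) S)"

definition partial :: "'n::finite \<Rightarrow> (real^'n \<Rightarrow> real) \<Rightarrow> real^'n \<Rightarrow> real" where
  "partial i g x = frechet_derivative g (at x) (axis i 1)"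

definition grad :: "(real^'n \<Rightarrow> real) \<Rightarrow> real^'n \<Rightarrow> real^'n" where
  "grad u x = (\<chi> i. partial i u x)"

definition divergence :: "(real^'n \<Rightarrow> real^'n) \<Rightarrow> real^'n \<Rightarrow> real" where
  "divergence F x = (\<Sum>i\<in>UNIV. partial i (\<lambda>y. F y $ i) x)"

text \<open>
  The equation is imposed classically on the open set where \<open>\<nabla>u \<noteq> 0\<close> and \<open>u\<close> is \<open>C\<^sup>3\<close>.
  At critical points \<open>u\<close> is only \<open>C\<^sup>1\<close>, so the left-hand side need not exist classically, and
  nothing is required there.  Solutions on all of the space in the classical, weak or
  distributional sense with this regularity satisfy the equation in the present sense.
\<close>

definition entire_solution :: "(real^'n \<Rightarrow> real) \<Rightarrow> (real^'n \<Rightarrow> real) \<Rightarrow> bool" where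
  "entire_solution f u \<longleftrightarrow>
     C_k_on 1 u UNIV \<and>
     C_k_on 3 u {x. norm (grad u x) > 0} \<and>
     (\<forall>x. norm (grad u x) > 0 \<longrightarrow>
        divergence (\<lambda>y. (1 / sqrt (1 + (norm (grad u y))\<^sup>2)) *\<^sub>R grad u y) x = f (grad u x))"

end

(*
  Bernstein's method with a maximum principle that only uses points where the gradient is nonzero.
  Write p = grad u, q = |p|, v = sqrt (1 + q^2), and A = I - p p^T / v^2, so that the equation is
  tr (A D^2 u) = v F(q).  Let L be the operator tr (A D^2 .) minus the drift given by the p-derivative
  of v F.  Differentiating the equation along p shows that ln v satisfies
  L (ln v) >= F^2 / n + |grad ln v|_A^2.  Hence at a local maximum of ln v + s, for any C^2 function s,
      F^2 / n + L s + |grad s|_A^2 <= 0.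
  Take s = - 1 / phi^m with phi = (1 - |x - a|^2 / R^2) / 4 + mu u - eps.  If grad u(a) is nonzero, then
  ln v dominates 1 / phi^m at the maximum, while the terms of L phi coming from the cutoff are O(1 / R).
  For (E1), (E2) take mu = 0 and m with (ln v)^(1 + 1/m) = O(F).  For (E3) take mu = - 1 / R^2, because
  - L u is of size q.  For (E4) take mu = R^(-1/3): there L u = 0, but |mu grad u|_A^2 is of order
  R^(-2/3), larger than 1 / R.
*)

theory Submission
  imports Defs "HOL-Real_Asymp.Real_Asymp"
begin

text \<open>The equation says nothing at critical points, so the maximum has to be kept away from
  them. This fixes the normalisation: phi <= 1/4 on the ball, so -1/phi^m <= -4^m wherever phi > 0,
  while at the centre a it lies below -4^m by an amount that tends to 0 with eps. Hence ln v at the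
  maximum is at least ln v(a) minus a small margin and stays positive. The eps in phi also pays for
  mu u on the boundary sphere. This explains the size of mu: mu u must be small on the ball of
  radius R, so |mu| is the inverse of the allowed growth at distance R. The pole of -1/phi^m serves
  two purposes. It keeps the maximum inside the ball, and it makes |grad s|_A^2, of order
  phi^(-2m-2), beat the concave part of L s, of order phi^(-m-2); phi <= 1/4 gives this for every m
  >= 1. No explicit gradient estimate is sought: a nonzero gradient at a fixed point a is shown to
  be incompatible with large R.\<close>

subsection \<open>Second derivatives\<close>

lemma second_difference_eq:
  fixes g a c :: "'a::real_normed_vector \<Rightarrow> real"
  assumes g: "\<And>y. y \<in> ball x r \<Longrightarrow> (g has_derivative g' y) (at y)"
    and a: "\<And>y. y \<in> ball x r \<Longrightarrow> ((\<lambda>y. g' y e) has_derivative a' y) (at y)"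
    and h: "0 < h" "h * (norm e + norm f) < r"
  obtains y where "y \<in> ball x r"
    and "g (x + h *\<^sub>R e + h *\<^sub>R f) - g (x + h *\<^sub>R e) - g (x + h *\<^sub>R f) + g x = h\<^sup>2 * a' y f"
proof -
  have in_ball: "x + s *\<^sub>R e + t *\<^sub>R f \<in> ball x r" if "0 \<le> s" "s \<le> h" "0 \<le> t" "t \<le> h" for s t
  proof -
    have "norm (s *\<^sub>R e + t *\<^sub>R f) \<le> s * norm e + t * norm f"
      using that by (intro norm_triangle_le) auto
    also have "\<dots> \<le> h * (norm e + norm f)"
      using that by (auto simp: algebra_simps intro!: add_mono mult_right_mono)
    finally show ?thesis
      using h by (auto simp: dist_norm norm_minus_commute algebra_simps)
  qed
  \<comment> \<open>Two applications of the mean value theorem: to the increment along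
    \<open>f\<close> as a function of the step along \<open>e\<close>, then to the
    \<open>e\<close>-derivative as a function of the step along \<open>f\<close>. Existence of the
    derivatives is enough here; continuity enters when the result is compared with its mirror
    image.\<close>
  define k where "k = (\<lambda>s. g (x + s *\<^sub>R e + h *\<^sub>R f) - g (x + s *\<^sub>R e))"
  have dk: "(k has_real_derivative
      g' (x + s *\<^sub>R e + h *\<^sub>R f) e - g' (x + s *\<^sub>R e) e) (at s)" if "0 \<le> s" "s \<le> h" for s
  proof -
    have 1: "((\<lambda>s. g (x + s *\<^sub>R e + t *\<^sub>R f)) has_derivative (\<lambda>z. g' (x + s *\<^sub>R e + t *\<^sub>R f) (z *\<^sub>R e))) (at s)"
      if "0 \<le> t" "t \<le> h" for t
      by (rule has_derivative_compose[of "\<lambda>s. x + s *\<^sub>R e + t *\<^sub>R f" _ _ _ g, OF _ g])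
        (use in_ball[of s t] \<open>0 \<le> s\<close> \<open>s \<le> h\<close> that in \<open>auto intro!: derivative_eq_intros\<close>)
    have lin: "g' (x + s *\<^sub>R e + t *\<^sub>R f) (z *\<^sub>R e) = z * g' (x + s *\<^sub>R e + t *\<^sub>R f) e"
      if "0 \<le> t" "t \<le> h" for t z
      using g[OF in_ball[of s t]] that \<open>0 \<le> s\<close> \<open>s \<le> h\<close>
      by (simp add: has_derivative_def bounded_linear.linear linear_scale)
    have 2: "((\<lambda>s. g (x + s *\<^sub>R e + t *\<^sub>R f)) has_real_derivative g' (x + s *\<^sub>R e + t *\<^sub>R f) e) (at s)"
      if "0 \<le> t" "t \<le> h" for t
      using 1[OF that] lin[OF that] by (simp add: has_field_derivative_def mult.commute[of _ "g' _ _"])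
    show ?thesis
      unfolding k_def using DERIV_diff[OF 2[of h] 2[of 0]] h by simp
  qed
  obtain s where s: "0 < s" "s < h"
      "k h - k 0 = (h - 0) * (g' (x + s *\<^sub>R e + h *\<^sub>R f) e - g' (x + s *\<^sub>R e) e)"
    using MVT2[OF h(1) dk] by blast
  have dl: "((\<lambda>t. g' (x + s *\<^sub>R e + t *\<^sub>R f) e) has_real_derivative
      a' (x + s *\<^sub>R e + t *\<^sub>R f) f) (at t)" if "0 \<le> t" "t \<le> h" for t
  proof -
    have 1: "((\<lambda>t. g' (x + s *\<^sub>R e + t *\<^sub>R f) e) has_derivative (\<lambda>z. a' (x + s *\<^sub>R e + t *\<^sub>R f) (z *\<^sub>R f))) (at t)"
      by (rule has_derivative_compose[of "\<lambda>t. x + s *\<^sub>R e + t *\<^sub>R f" _ _ _ "\<lambda>y. g' y e", OF _ a])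
        (use in_ball[of s t] s that in \<open>auto intro!: derivative_eq_intros\<close>)
    have lin: "a' (x + s *\<^sub>R e + t *\<^sub>R f) (z *\<^sub>R f) = z * a' (x + s *\<^sub>R e + t *\<^sub>R f) f" for z
      using a[OF in_ball[of s t]] that s
      by (simp add: has_derivative_def bounded_linear.linear linear_scale)
    show ?thesis
      using 1 lin by (simp add: has_field_derivative_def mult.commute[of _ "a' _ _"])
  qed
  obtain t where t: "0 < t" "t < h"
      "g' (x + s *\<^sub>R e + h *\<^sub>R f) e - g' (x + s *\<^sub>R e + 0 *\<^sub>R f) e = (h - 0) * a' (x + s *\<^sub>R e + t *\<^sub>R f) f"
    using MVT2[OF h(1) dl] by blast
  show thesis
  proof
    show "x + s *\<^sub>R e + t *\<^sub>R f \<in> ball x r"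
      using in_ball s t by simp
    show "g (x + h *\<^sub>R e + h *\<^sub>R f) - g (x + h *\<^sub>R e) - g (x + h *\<^sub>R f) + g x
        = h\<^sup>2 * a' (x + s *\<^sub>R e + t *\<^sub>R f) f"
      using s(3) t(3) by (simp add: k_def power2_eq_square)
  qed
qed

text \<open>The second difference of \<open>second_difference_eq\<close> does not change when
  \<open>e\<close> and \<open>f\<close> are exchanged, so the two mixed derivatives agree when each
  is taken at a suitable point near \<open>x\<close>. If they differed at \<open>x\<close>,
  continuity would keep them apart on a whole ball. Continuity is asked for fixed directions only,
  which is the form that \<open>C_k_on\<close> provides.\<close>

theorem symmetric_second_derivative:
  fixes g :: "'a::real_normed_vector \<Rightarrow> real"
  assumes "open S" "x \<in> S"
    and g: "\<And>y. y \<in> S \<Longrightarrow> (g has_derivative g' y) (at y)"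
    and a: "\<And>y v. y \<in> S \<Longrightarrow> ((\<lambda>y. g' y v) has_derivative g'' y v) (at y)"
    and cont: "\<And>v w. continuous_on S (\<lambda>y. g'' y v w)"
  shows "g'' x e f = g'' x f e"
proof (rule ccontr)
  assume neq: "g'' x e f \<noteq> g'' x f e"
  define \<epsilon> where "\<epsilon> = \<bar>g'' x e f - g'' x f e\<bar> / 2"
  have "\<epsilon> > 0" using neq by (simp add: \<epsilon>_def)
  have lim: "((\<lambda>y. g'' y v w) \<longlongrightarrow> g'' x v w) (nhds x)" for v w
    using cont[of v w] assms(1,2)
    by (metis continuous_on_eq_continuous_at isCont_def tendsto_at_iff_tendsto_nhds)
  have "\<forall>\<^sub>F y in nhds x. y \<in> S \<and> dist (g'' y e f) (g'' x e f) < \<epsilon> \<and> dist (g'' y f e) (g'' x f e) < \<epsilon>"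
    using tendstoD[OF lim \<open>\<epsilon> > 0\<close>] tendstoD[OF lim \<open>\<epsilon> > 0\<close>] eventually_nhds_in_open[OF assms(1,2)]
    by (intro eventually_conj)
  then obtain r where r: "r > 0" and near: "\<And>y. y \<in> ball x r \<Longrightarrow>
      y \<in> S \<and> dist (g'' y e f) (g'' x e f) < \<epsilon> \<and> dist (g'' y f e) (g'' x f e) < \<epsilon>"
    unfolding eventually_nhds_metric by (auto simp: dist_commute)
  define h where "h = r / (2 * (norm e + norm f + 1))"
  have pos: "norm e + norm f + 1 > 0" by (smt (verit) norm_ge_zero)
  have h: "h > 0" using r pos by (simp add: h_def)
  have "h * (norm e + norm f) < h * (2 * (norm e + norm f + 1))"
    using h by (intro mult_strict_left_mono) (auto simp: add_nonneg_pos intro: add_nonneg_nonneg)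
  also have "\<dots> = r" using pos by (simp add: h_def)
  finally have hr: "h * (norm e + norm f) < r" .
  obtain y where y: "y \<in> ball x r"
    "g (x + h *\<^sub>R e + h *\<^sub>R f) - g (x + h *\<^sub>R e) - g (x + h *\<^sub>R f) + g x = h\<^sup>2 * g'' y e f"
    by (rule second_difference_eq[of x r g g' e "\<lambda>y. g'' y e" h f]) (use near g a h hr in auto)
  obtain z where z: "z \<in> ball x r"
    "g (x + h *\<^sub>R f + h *\<^sub>R e) - g (x + h *\<^sub>R f) - g (x + h *\<^sub>R e) + g x = h\<^sup>2 * g'' z f e"
    by (rule second_difference_eq[of x r g g' f "\<lambda>y. g'' y f" h e]) (use near g a h hr in \<open>auto simp: add.commute\<close>)
  have "h\<^sup>2 * g'' y e f = h\<^sup>2 * g'' z f e"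
    using y(2) z(2) by (simp add: algebra_simps)
  then have "g'' y e f = g'' z f e" using h by simp
  then show False
    using near[OF y(1)] near[OF z(1)] unfolding \<epsilon>_def dist_real_def by (smt (verit) field_sum_of_halves)
qed

text \<open>If \<open>\<gamma>''\<close> were positive, \<open>\<gamma>'\<close> would be positive
  just to the right of its zero \<open>a\<close>, and \<open>\<gamma>\<close> would increase there.
  The second derivative is required at \<open>a\<close> alone, so third derivatives of the solution
  are evaluated only at the maximum point.\<close>

lemma DERIV_local_max_second:
  fixes \<gamma> :: "real \<Rightarrow> real"
  assumes "\<delta> > 0"
    and max: "\<And>t. \<bar>t - a\<bar> < \<delta> \<Longrightarrow> \<gamma> t \<le> \<gamma> a"
    and d1: "\<And>t. \<bar>t - a\<bar> < \<delta> \<Longrightarrow> (\<gamma> has_real_derivative \<gamma>' t) (at t)"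
    and d2: "(\<gamma>' has_real_derivative \<gamma>'') (at a)"
  shows "\<gamma>' a = 0" "\<gamma>'' \<le> 0"
proof -
  show 0: "\<gamma>' a = 0"
    by (rule DERIV_local_max[OF d1 \<open>\<delta> > 0\<close>]) (use assms(1) max in \<open>auto simp: abs_minus_commute\<close>)
  show "\<gamma>'' \<le> 0"
  proof (rule ccontr)
    assume "\<not> \<gamma>'' \<le> 0"
    then obtain d where d: "d > 0" "\<And>h. h > 0 \<Longrightarrow> h < d \<Longrightarrow> \<gamma>' a < \<gamma>' (a + h)"
      using DERIV_pos_inc_right[OF d2] by auto
    define b where "b = a + min d \<delta> / 2"
    have b: "a < b" "b < a + d" "b < a + \<delta>" using d(1) \<open>\<delta> > 0\<close> by (auto simp: b_def min_def)
    obtain z where z: "a < z" "z < b" "\<gamma> b - \<gamma> a = (b - a) * \<gamma>' z"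
      using MVT2[of a b \<gamma> \<gamma>'] b d1 by auto
    have "\<gamma>' z > 0" using d(2)[of "z - a"] z b 0 by auto
    then have "\<gamma> b > \<gamma> a" using z b by (smt (verit) mult_pos_pos)
    then show False using max[of b] b by auto
  qed
qed

subsection \<open>Bernstein's inequality\<close>

text \<open>\<open>tilt p\<close> is the symmetric square root of \<open>I - p p\<^sup>T / (1 + |p|\<^sup>2)\<close>.\<close>

definition tilt :: "'a::euclidean_space \<Rightarrow> 'a \<Rightarrow> 'a" where
  "tilt p y = y - (p \<bullet> y / (sqrt (1 + p \<bullet> p) * (sqrt (1 + p \<bullet> p) + 1))) *\<^sub>R p"

text \<open>\<open>tilt p\<close> is self-adjoint of the form I - c p p^T, and its square is I - (2c
  - c^2 |p|^2) p p^T; the value of c makes the bracket equal to 1 / v^2. Working with the root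
  instead of A turns traces against A into sums over the vectors \<open>tilt p b\<close>, so that
  tests along single directions can be added up and Cauchy-Schwarz applies to the summands.\<close>

lemma sum_tilt_inner:
  "(\<Sum>b\<in>Basis. (y \<bullet> tilt p b) * (z \<bullet> tilt p b)) = y \<bullet> z - (p \<bullet> y) * (p \<bullet> z) / (1 + p \<bullet> p)"
proof -
  define v where "v = sqrt (1 + p \<bullet> p)"
  define c where "c = 1 / (v * (v + 1))"
  have v: "v \<ge> 1" "p \<bullet> p = v\<^sup>2 - 1" by (auto simp: v_def)
  have cv: "c * v = 1 / (v + 1)" using v by (simp add: c_def)
  have "v\<^sup>2 * (2 * c - c\<^sup>2 * (v\<^sup>2 - 1)) = 2 * v * (c * v) - (c * v)\<^sup>2 * ((v + 1) * (v - 1))"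
    by (simp add: algebra_simps power2_eq_square)
  also have "\<dots> = 1"
    using v unfolding cv by (simp add: divide_simps power2_eq_square)
  finally have c: "2 * c - c\<^sup>2 * (v\<^sup>2 - 1) = 1 / v\<^sup>2"
    using v by (simp add: field_simps)
  have t: "y \<bullet> tilt p b = (y - (c * (p \<bullet> y)) *\<^sub>R p) \<bullet> b" for y b
    by (simp add: tilt_def v_def[symmetric] c_def inner_simps inner_commute)
  have "(\<Sum>b\<in>Basis. (y \<bullet> tilt p b) * (z \<bullet> tilt p b))
      = (y - (c * (p \<bullet> y)) *\<^sub>R p) \<bullet> (z - (c * (p \<bullet> z)) *\<^sub>R p)"
    unfolding t by (rule euclidean_inner[symmetric])
  also have "\<dots> = y \<bullet> z - (p \<bullet> y) * (p \<bullet> z) * (2 * c - c\<^sup>2 * (p \<bullet> p))"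
    by (simp add: inner_simps inner_commute algebra_simps power2_eq_square)
  finally show ?thesis
    using c v by simp
qed

text \<open>For K the Hessian of u, the right-hand side is the left-hand side of the equation in
  nondivergence form. No symmetry of K is required: K is expanded over the basis and
  \<open>sum_tilt_inner\<close> is applied to each pair.\<close>

lemma sum_tilt_linear:
  assumes "linear K"
  shows "(\<Sum>b\<in>Basis. K (tilt p b) \<bullet> tilt p b) = (\<Sum>b\<in>Basis. K b \<bullet> b) - (K p \<bullet> p) / (1 + p \<bullet> p)"
proof -
  have K: "K y = (\<Sum>i\<in>Basis. (i \<bullet> y) *\<^sub>R K i)" for y
    using linear_sum[OF assms, of "\<lambda>i. (y \<bullet> i) *\<^sub>R i" Basis]
    unfolding euclidean_representation by (simp add: linear_scale[OF assms] inner_commute)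
  have "(\<Sum>b\<in>Basis. K (tilt p b) \<bullet> tilt p b)
      = (\<Sum>b\<in>Basis. \<Sum>i\<in>Basis. (i \<bullet> tilt p b) * (K i \<bullet> tilt p b))"
    by (subst K) (simp add: inner_sum_left)
  also have "\<dots> = (\<Sum>i\<in>Basis. i \<bullet> K i - (p \<bullet> i) * (p \<bullet> K i) / (1 + p \<bullet> p))"
    by (subst sum.swap) (simp add: sum_tilt_inner)
  also have "\<dots> = (\<Sum>i\<in>Basis. K i \<bullet> i) - (\<Sum>i\<in>Basis. (i \<bullet> p) * (K i \<bullet> p)) / (1 + p \<bullet> p)"
    by (simp add: sum_subtractf sum_divide_distrib inner_commute)
  also have "(\<Sum>i\<in>Basis. (i \<bullet> p) * (K i \<bullet> p)) = K p \<bullet> p"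
    by (subst (2) K) (simp add: inner_sum_left)
  finally show ?thesis .
qed

text \<open>At the maximum the second derivative of ln v + \<open>\<sigma>\<close> is at most 0
  along each \<open>tilt p b\<close>; the sum of these tests is a trace against A. Its third-order
  part is removed by differentiating the equation along p, its quadratic part is bounded below by
  Cauchy-Schwarz, and the vanishing first derivative expresses \<open>h p\<close> through
  \<open>s x\<close>. \<open>B\<close> is v F as a function of |p|^2, so \<open>2 * B'\<close> times
  p is the drift. Here \<open>g\<close>, \<open>H\<close>, \<open>T\<close> stand for the first
  three derivatives of u, and \<open>T \<eta> \<xi>\<close> is the derivative of
  \<open>H y \<xi>\<close> in direction \<open>\<eta>\<close>.\<close>

lemma bernstein_at_max:
  fixes g :: "'a::euclidean_space \<Rightarrow> 'a" and B :: "real \<Rightarrow> real"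
  assumes S: "open S" "x \<in> S"
    and g: "\<And>y. y \<in> S \<Longrightarrow> (g has_derivative H y) (at y)"
    and T: "\<And>\<xi>. ((\<lambda>y. H y \<xi>) has_derivative (\<lambda>\<eta>. T \<eta> \<xi>)) (at x)"
    and symH: "\<And>y \<xi> \<eta>. y \<in> S \<Longrightarrow> H y \<xi> \<bullet> \<eta> = H y \<eta> \<bullet> \<xi>"
    and symT: "\<And>\<xi> \<eta> \<zeta>. T \<eta> \<xi> \<bullet> \<zeta> = T \<eta> \<zeta> \<bullet> \<xi>" "\<And>\<xi> \<eta>. T \<eta> \<xi> = T \<xi> \<eta>"
    and eq: "\<And>y. y \<in> S \<Longrightarrow>
      (\<Sum>b\<in>Basis. H y b \<bullet> b) - (H y (g y) \<bullet> g y) / (1 + g y \<bullet> g y) = B (g y \<bullet> g y)"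
    and B: "(B has_real_derivative B') (at (g x \<bullet> g x))"
    and s: "\<And>y. y \<in> S \<Longrightarrow> (\<sigma> has_derivative (\<lambda>\<xi>. s y \<bullet> \<xi>)) (at y)"
    and K: "(s has_derivative K) (at x)"
    and max: "\<And>y. y \<in> S \<Longrightarrow> ln (1 + g y \<bullet> g y) / 2 + \<sigma> y \<le> ln (1 + g x \<bullet> g x) / 2 + \<sigma> x"
  shows "(B (g x \<bullet> g x))\<^sup>2 / (DIM('a) * (1 + g x \<bullet> g x)) + (\<Sum>b\<in>Basis. K (tilt (g x) b) \<bullet> tilt (g x) b)
    - 2 * B' * (s x \<bullet> g x) + (\<Sum>b\<in>Basis. (s x \<bullet> tilt (g x) b)\<^sup>2) \<le> 0"
proof -
  define p where "p = g x"
  define V where "V = 1 + p \<bullet> p"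
  define h where "h = H x"
  have V: "V > 0" by (simp add: V_def add_pos_nonneg)
  have V': "1 + g y \<bullet> g y > 0" for y by (simp add: add_pos_nonneg)
  have V0: "1 + g y \<bullet> g y \<noteq> 0" for y using V'[of y] by linarith
  have linH: "linear (H y)" if "y \<in> S" for y
    using g[OF that] by (simp add: has_derivative_linear)
  have linh: "linear h" using linH S by (simp add: h_def)
  have symh: "h \<xi> \<bullet> \<eta> = h \<eta> \<bullet> \<xi>" for \<xi> \<eta> using symH S by (simp add: h_def)
  obtain r where r: "r > 0" "ball x r \<subseteq> S" using S openE by blast
  have line: "\<exists>\<delta>>0. \<forall>t. \<bar>t\<bar> < \<delta> \<longrightarrow> x + t *\<^sub>R \<xi> \<in> S" for \<xi>
  proof (intro exI conjI allI impI)
    show "r / (norm \<xi> + 1) > 0" using r by (simp add: add_nonneg_pos)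
    fix t :: real assume "\<bar>t\<bar> < r / (norm \<xi> + 1)"
    then have "\<bar>t\<bar> * (norm \<xi> + 1) < r" by (simp add: pos_less_divide_eq add_nonneg_pos)
    then have "norm (t *\<^sub>R \<xi>) < r" by (simp add: algebra_simps)
    then show "x + t *\<^sub>R \<xi> \<in> S" using r by (auto simp: subset_iff dist_norm)
  qed
  have g_line: "((\<lambda>t. g (x + t *\<^sub>R \<xi>)) has_vector_derivative H (x + t *\<^sub>R \<xi>) \<xi>) (at t)"
    if "x + t *\<^sub>R \<xi> \<in> S" for \<xi> t
  proof -
    have "((\<lambda>t. g (x + t *\<^sub>R \<xi>)) has_derivative (\<lambda>z. H (x + t *\<^sub>R \<xi>) (z *\<^sub>R \<xi>))) (at t)"
      by (rule has_derivative_compose[of "\<lambda>t. x + t *\<^sub>R \<xi>" _ _ _ g, OF _ g])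
        (use that in \<open>auto intro!: derivative_eq_intros\<close>)
    then show ?thesis
      by (simp add: has_vector_derivative_def linear_scale[OF linH[OF that]])
  qed
  have s_line: "((\<lambda>t. \<sigma> (x + t *\<^sub>R \<xi>)) has_real_derivative s (x + t *\<^sub>R \<xi>) \<bullet> \<xi>) (at t)"
    if "x + t *\<^sub>R \<xi> \<in> S" for \<xi> t
  proof -
    have "((\<lambda>t. \<sigma> (x + t *\<^sub>R \<xi>)) has_derivative (\<lambda>z. s (x + t *\<^sub>R \<xi>) \<bullet> (z *\<^sub>R \<xi>))) (at t)"
      by (rule has_derivative_compose[of "\<lambda>t. x + t *\<^sub>R \<xi>" _ _ _ \<sigma>, OF _ s])
        (use that in \<open>auto intro!: derivative_eq_intros\<close>)
    then show ?thesis
      by (simp add: has_field_derivative_def mult.commute[of _ "s _ \<bullet> _"])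
  qed
  have H_line: "((\<lambda>t. H (x + t *\<^sub>R \<xi>) \<eta>) has_vector_derivative T \<xi> \<eta>) (at 0)" for \<xi> \<eta>
  proof -
    have "((\<lambda>t. H (x + t *\<^sub>R \<xi>) \<eta>) has_derivative (\<lambda>z. T (z *\<^sub>R \<xi>) \<eta>)) (at 0)"
      by (rule has_derivative_compose[of "\<lambda>t. x + t *\<^sub>R \<xi>" _ _ _ "\<lambda>y. H y \<eta>"])
        (use T[of \<eta>] in \<open>auto intro!: derivative_eq_intros\<close>)
    then show ?thesis
      by (simp add: has_vector_derivative_def linear_scale[OF has_derivative_linear[OF T[of \<eta>]]])
  qed
  have K_line: "((\<lambda>t. s (x + t *\<^sub>R \<xi>)) has_vector_derivative K \<xi>) (at 0)" for \<xi>
  proof -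
    have "((\<lambda>t. s (x + t *\<^sub>R \<xi>)) has_derivative (\<lambda>z. K (z *\<^sub>R \<xi>))) (at 0)"
      by (rule has_derivative_compose[of "\<lambda>t. x + t *\<^sub>R \<xi>" _ _ _ s])
        (use K in \<open>auto intro!: derivative_eq_intros\<close>)
    then show ?thesis
      using has_derivative_linear[OF K] by (simp add: has_vector_derivative_def linear_scale)
  qed
  have inner_line: "((\<lambda>t. a t \<bullet> b t) has_real_derivative a t \<bullet> b' + a' \<bullet> b t) (at t)"
    if "(a has_vector_derivative a') (at t)" "(b has_vector_derivative b') (at t)"
    for a b :: "real \<Rightarrow> 'a" and a' b' t
    using bounded_bilinear.has_vector_derivative[OF bounded_bilinear_inner that]
    by (simp add: has_real_derivative_iff_has_vector_derivative)
  have half: "inverse a * (2 * b) / 2 = b / a" for a b :: real by (simp add: field_simps)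
  \<comment> \<open>First and second derivative tests on the line through \<open>x\<close> in
    direction \<open>\<xi>\<close>. The symmetries of \<open>T\<close> rewrite the third-order term
    as \<open>T p \<xi> \<bullet> \<xi>\<close>, the derivative of the Hessian along p, because this
    is what differentiating the equation along p produces.\<close>
  have test: "p \<bullet> h \<xi> = - V * (s x \<bullet> \<xi>)"
    "(h \<xi> \<bullet> h \<xi> + T p \<xi> \<bullet> \<xi>) / V - 2 * (h p \<bullet> \<xi>)\<^sup>2 / V\<^sup>2 + K \<xi> \<bullet> \<xi> \<le> 0" for \<xi>
  proof -
    obtain \<delta> where \<delta>: "\<delta> > 0" "\<And>t. \<bar>t - 0\<bar> < \<delta> \<Longrightarrow> x + t *\<^sub>R \<xi> \<in> S"
      using line[of \<xi>] by auto
    define \<gamma> where "\<gamma> = (\<lambda>t. ln (1 + g (x + t *\<^sub>R \<xi>) \<bullet> g (x + t *\<^sub>R \<xi>)) / 2 + \<sigma> (x + t *\<^sub>R \<xi>))"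
    define \<gamma>' where "\<gamma>' = (\<lambda>t. (g (x + t *\<^sub>R \<xi>) \<bullet> H (x + t *\<^sub>R \<xi>) \<xi>) / (1 + g (x + t *\<^sub>R \<xi>) \<bullet> g (x + t *\<^sub>R \<xi>))
       + s (x + t *\<^sub>R \<xi>) \<bullet> \<xi>)"
    define \<gamma>'' where "\<gamma>'' = (h \<xi> \<bullet> h \<xi> + T p \<xi> \<bullet> \<xi>) / V - 2 * (h p \<bullet> \<xi>)\<^sup>2 / V\<^sup>2 + K \<xi> \<bullet> \<xi>"
    have d1: "(\<gamma> has_real_derivative \<gamma>' t) (at t)" if "\<bar>t - 0\<bar> < \<delta>" for t
    proof -
      have i: "x + t *\<^sub>R \<xi> \<in> S" using \<delta>(2) that by simp
      have "((\<lambda>t. 1 + g (x + t *\<^sub>R \<xi>) \<bullet> g (x + t *\<^sub>R \<xi>)) has_real_derivative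
          2 * (g (x + t *\<^sub>R \<xi>) \<bullet> H (x + t *\<^sub>R \<xi>) \<xi>)) (at t)"
        using DERIV_add[OF DERIV_const inner_line[OF g_line[OF i] g_line[OF i]]] by (simp add: inner_commute)
      then have "((\<lambda>t. ln (1 + g (x + t *\<^sub>R \<xi>) \<bullet> g (x + t *\<^sub>R \<xi>))) has_real_derivative
          inverse (1 + g (x + t *\<^sub>R \<xi>) \<bullet> g (x + t *\<^sub>R \<xi>)) *
          (2 * (g (x + t *\<^sub>R \<xi>) \<bullet> H (x + t *\<^sub>R \<xi>) \<xi>))) (at t)"
        by (rule DERIV_chain2[where f = ln, rotated]) (rule DERIV_ln[OF V'])
      then have "(\<gamma> has_real_derivative
          inverse (1 + g (x + t *\<^sub>R \<xi>) \<bullet> g (x + t *\<^sub>R \<xi>)) *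
          (2 * (g (x + t *\<^sub>R \<xi>) \<bullet> H (x + t *\<^sub>R \<xi>) \<xi>)) / 2 + s (x + t *\<^sub>R \<xi>) \<bullet> \<xi>) (at t)"
        unfolding \<gamma>_def by (intro DERIV_add DERIV_cdivide s_line i)
      then show ?thesis
        by (simp only: \<gamma>'_def half)
    qed
    have in0: "x + 0 *\<^sub>R \<xi> \<in> S" using S by simp
    have d2: "(\<gamma>' has_real_derivative \<gamma>'') (at 0)"
    proof -
      have N: "((\<lambda>t. g (x + t *\<^sub>R \<xi>) \<bullet> H (x + t *\<^sub>R \<xi>) \<xi>) has_real_derivative
          h \<xi> \<bullet> h \<xi> + T p \<xi> \<bullet> \<xi>) (at 0)"
        using inner_line[OF g_line[OF in0] H_line[of \<xi> \<xi>]] symT(1)[of \<xi> \<xi> p] symT(2)[of \<xi> p]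
        by (simp add: p_def[symmetric] h_def[symmetric] inner_commute add.commute)
      have D: "((\<lambda>t. 1 + g (x + t *\<^sub>R \<xi>) \<bullet> g (x + t *\<^sub>R \<xi>)) has_real_derivative 2 * (h p \<bullet> \<xi>)) (at 0)"
        using DERIV_add[OF DERIV_const inner_line[OF g_line[OF in0] g_line[OF in0]]] symh[of p \<xi>]
        by (simp add: p_def[symmetric] h_def[symmetric] inner_commute)
      have S: "((\<lambda>t. s (x + t *\<^sub>R \<xi>) \<bullet> \<xi>) has_real_derivative K \<xi> \<bullet> \<xi>) (at 0)"
        using inner_line[OF K_line has_vector_derivative_const[of \<xi>]] by simp
      have "p \<bullet> h \<xi> = h p \<bullet> \<xi>" using symh[of p \<xi>] by (simp add: inner_commute)
      then show ?thesis
        using DERIV_add[OF DERIV_divide[OF N D V0] S] V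
        by (simp add: \<gamma>'_def \<gamma>''_def p_def[symmetric] h_def[symmetric] V_def[symmetric]
            diff_divide_distrib power2_eq_square mult_ac)
    qed
    have max0: "\<gamma> t \<le> \<gamma> 0" if "\<bar>t - 0\<bar> < \<delta>" for t
      using max[OF \<delta>(2)[OF that]] by (simp add: \<gamma>_def)
    have "\<gamma>' 0 = 0" "\<gamma>'' \<le> 0"
      using DERIV_local_max_second[OF \<delta>(1) max0 d1 d2] by auto
    then show "(h \<xi> \<bullet> h \<xi> + T p \<xi> \<bullet> \<xi>) / V - 2 * (h p \<bullet> \<xi>)\<^sup>2 / V\<^sup>2 + K \<xi> \<bullet> \<xi> \<le> 0"
      by (simp only: \<gamma>''_def)
    have "p \<bullet> h \<xi> / V = - (s x \<bullet> \<xi>)"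
      using \<open>\<gamma>' 0 = 0\<close> by (simp add: \<gamma>'_def p_def[symmetric] h_def[symmetric] V_def[symmetric])
    then show "p \<bullet> h \<xi> = - V * (s x \<bullet> \<xi>)"
      using V by (simp add: divide_eq_eq)
  qed
  have lin_eq: "(\<Sum>b\<in>Basis. T p b \<bullet> b) - (T p p \<bullet> p + 2 * (h p \<bullet> h p)) / V + 2 * (h p \<bullet> p)\<^sup>2 / V\<^sup>2
      = 2 * B' * (h p \<bullet> p)"
  proof -
    obtain \<delta> where \<delta>: "\<delta> > 0" "\<And>t. \<bar>t\<bar> < \<delta> \<Longrightarrow> x + t *\<^sub>R p \<in> S"
      using line[of p] by auto
    \<comment> \<open>The quadratic term is expanded over the basis because the Hessian is known to
      be differentiable only for a fixed argument, whereas its argument \<open>g\<close> moves along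
      the line as well.\<close>
    define L where "L = (\<lambda>t. (\<Sum>b\<in>Basis. H (x + t *\<^sub>R p) b \<bullet> b)
       - (\<Sum>b\<in>Basis. (g (x + t *\<^sub>R p) \<bullet> b) * (H (x + t *\<^sub>R p) b \<bullet> g (x + t *\<^sub>R p)))
         / (1 + g (x + t *\<^sub>R p) \<bullet> g (x + t *\<^sub>R p)))"
    have basis_sum: "(\<Sum>b\<in>Basis. (q \<bullet> b) * w b) = q \<bullet> z" if "\<And>b. w b = z \<bullet> b" for q z :: 'a and w
      by (simp add: that euclidean_inner[of q z])
    have L: "L t = B (g (x + t *\<^sub>R p) \<bullet> g (x + t *\<^sub>R p))" if "\<bar>t\<bar> < \<delta>" for t
    proof -
      have "(\<Sum>b\<in>Basis. (q \<bullet> b) * (H y b \<bullet> q)) = H y q \<bullet> q" if "y \<in> S" for y q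
        by (subst inner_commute[of "H y q" q], rule basis_sum, rule symH[OF that])
      then show ?thesis
        using eq[OF \<delta>(2)[OF that]] \<delta>(2)[OF that] by (simp add: L_def)
    qed
    have in0: "x + 0 *\<^sub>R p \<in> S" using S by simp
    have s1: "(\<Sum>b\<in>Basis. (p \<bullet> b) * (T p b \<bullet> p)) = p \<bullet> T p p"
      by (rule basis_sum) (rule symT(1))
    have s2: "(\<Sum>b\<in>Basis. (p \<bullet> b) * (h b \<bullet> h p)) = p \<bullet> h (h p)"
      by (rule basis_sum) (rule symh)
    have s3: "(\<Sum>b\<in>Basis. (h p \<bullet> b) * (h b \<bullet> p)) = h p \<bullet> h p"
      by (rule basis_sum) (rule symh)
    have s4: "(\<Sum>b\<in>Basis. (p \<bullet> b) * (h b \<bullet> p)) = p \<bullet> h p"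
      by (rule basis_sum) (rule symh)
    have s5: "p \<bullet> h (h p) = h p \<bullet> h p"
      using symh[of p "h p"] by (simp add: inner_commute)
    have "(L has_real_derivative (\<Sum>b\<in>Basis. T p b \<bullet> b)
        - ((\<Sum>b\<in>Basis. (p \<bullet> b) * (T p b \<bullet> p) + (p \<bullet> b) * (h b \<bullet> h p) + (h p \<bullet> b) * (h b \<bullet> p)) * V
           - (\<Sum>b\<in>Basis. (p \<bullet> b) * (h b \<bullet> p)) * (2 * (h p \<bullet> p))) / (V * V)) (at 0)"
    proof -
      have g2: "((\<lambda>t. 1 + g (x + t *\<^sub>R p) \<bullet> g (x + t *\<^sub>R p)) has_real_derivative 2 * (h p \<bullet> p)) (at 0)"
        using DERIV_add[OF DERIV_const inner_line[OF g_line[OF in0] g_line[OF in0]]]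
        by (simp add: p_def[symmetric] h_def[symmetric] inner_commute)
      have tr: "((\<lambda>t. \<Sum>b\<in>Basis. H (x + t *\<^sub>R p) b \<bullet> b) has_real_derivative (\<Sum>b\<in>Basis. T p b \<bullet> b)) (at 0)"
        using inner_line[OF H_line has_vector_derivative_const] by (intro DERIV_sum) simp
      have quad: "((\<lambda>t. \<Sum>b\<in>Basis. (g (x + t *\<^sub>R p) \<bullet> b) * (H (x + t *\<^sub>R p) b \<bullet> g (x + t *\<^sub>R p)))
          has_real_derivative
          (\<Sum>b\<in>Basis. (p \<bullet> b) * (T p b \<bullet> p) + (p \<bullet> b) * (h b \<bullet> h p) + (h p \<bullet> b) * (h b \<bullet> p))) (at 0)"
      proof (rule DERIV_sum)
        fix b :: 'a
        have "((\<lambda>t. g (x + t *\<^sub>R p) \<bullet> b) has_real_derivative h p \<bullet> b) (at 0)"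
          using inner_line[OF g_line[OF in0] has_vector_derivative_const[of b]] by (simp add: h_def)
        from DERIV_mult[OF this inner_line[OF H_line[of p b] g_line[OF in0]]]
        show "((\<lambda>t. (g (x + t *\<^sub>R p) \<bullet> b) * (H (x + t *\<^sub>R p) b \<bullet> g (x + t *\<^sub>R p)))
          has_real_derivative
          (p \<bullet> b) * (T p b \<bullet> p) + (p \<bullet> b) * (h b \<bullet> h p) + (h p \<bullet> b) * (h b \<bullet> p)) (at 0)"
          by (simp add: p_def[symmetric] h_def[symmetric] algebra_simps)
      qed
      show ?thesis
        using DERIV_diff[OF tr DERIV_divide[OF quad g2 V0]]
        by (simp add: L_def p_def[symmetric] h_def[symmetric] V_def[symmetric])
    qed
    then have dL: "(L has_real_derivative (\<Sum>b\<in>Basis. T p b \<bullet> b)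
        - ((T p p \<bullet> p + 2 * (h p \<bullet> h p)) * V - (h p \<bullet> p) * (2 * (h p \<bullet> p))) / (V * V)) (at 0)"
      by (simp add: sum.distrib s1 s2 s3 s4 s5 inner_commute[of p "T p p"] inner_commute[of p "h p"] add.commute)
    have "(L has_real_derivative B' * (2 * (h p \<bullet> p))) (at 0)"
    proof (rule has_field_derivative_transform_within_open)
      have g2: "((\<lambda>t. g (x + t *\<^sub>R p) \<bullet> g (x + t *\<^sub>R p)) has_real_derivative 2 * (h p \<bullet> p)) (at 0)"
        using inner_line[OF g_line[OF in0] g_line[OF in0]]
        by (simp add: p_def[symmetric] h_def[symmetric] inner_commute)
      show "((\<lambda>t. B (g (x + t *\<^sub>R p) \<bullet> g (x + t *\<^sub>R p))) has_real_derivative B' * (2 * (h p \<bullet> p))) (at 0)"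
        by (rule DERIV_chain2[OF _ g2]) (use B in simp)
    qed (use \<delta> L in \<open>auto simp: abs_if split: if_splits intro!: open_greaterThanLessThan[of "- \<delta>" \<delta>]\<close>)
    from DERIV_unique[OF dL this] show ?thesis
      using V by (simp add: field_simps power2_eq_square)
  qed
  have linT: "linear (T p)"
  proof -
    have "T p = (\<lambda>\<eta>. T \<eta> p)" using symT(2)[of p] by auto
    then show ?thesis using has_derivative_linear[OF T[of p]] by simp
  qed
  have sumT: "(\<Sum>b\<in>Basis. T p (tilt p b) \<bullet> tilt p b)
      = 2 * B' * (h p \<bullet> p) + 2 * (h p \<bullet> h p) / V - 2 * (h p \<bullet> p)\<^sup>2 / V\<^sup>2"
    using sum_tilt_linear[OF linT, of p] lin_eq unfolding V_def by (simp add: add_divide_distrib algebra_simps)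
  have sumhp: "(\<Sum>b\<in>Basis. (h p \<bullet> tilt p b)\<^sup>2) = h p \<bullet> h p - (h p \<bullet> p)\<^sup>2 / V"
    using sum_tilt_inner[of "h p" p "h p"] by (simp add: power2_eq_square V_def inner_commute)
  have hp: "h p \<bullet> \<xi> = - V * (s x \<bullet> \<xi>)" for \<xi>
    using test(1)[of \<xi>] symh[of p \<xi>] by (simp add: inner_commute)
  define G where "G = (\<Sum>b\<in>Basis. (s x \<bullet> tilt p b)\<^sup>2)"
  have sumhp': "(\<Sum>b\<in>Basis. (h p \<bullet> tilt p b)\<^sup>2) = V\<^sup>2 * G"
    by (simp add: hp G_def power_mult_distrib sum_distrib_left)
  have trace: "(\<Sum>b\<in>Basis. h (tilt p b) \<bullet> tilt p b) = B (p \<bullet> p)"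
    using eq[OF S(2)] sum_tilt_linear[OF linh, of p] by (simp add: h_def p_def)
  have "(B (p \<bullet> p))\<^sup>2 \<le> DIM('a) * (\<Sum>b\<in>(Basis::'a set). (h (tilt p b) \<bullet> tilt p b)\<^sup>2)"
    using sum_squared_le_sum_of_squares[of "\<lambda>b. h (tilt p b) \<bullet> tilt p b" Basis] trace
    by (simp add: mult.commute)
  then have "(B (p \<bullet> p))\<^sup>2 / DIM('a) \<le> (\<Sum>b\<in>Basis. (h (tilt p b) \<bullet> tilt p b)\<^sup>2)"
    by (simp add: field_simps)
  \<comment> \<open>Each diagonal entry of the matrix with entries
    \<open>h (tilt p b) \<bullet> tilt p l\<close> is one entry of its row, and
    \<open>sum_tilt_inner\<close> evaluates the squared norm of the row. The subtracted part sums to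
    \<open>V * G\<close> by the first derivative test.\<close>
  also have "\<dots> \<le> (\<Sum>b\<in>Basis. h (tilt p b) \<bullet> h (tilt p b) - (p \<bullet> h (tilt p b))\<^sup>2 / V)"
  proof (rule sum_mono)
    fix b :: 'a assume b: "b \<in> Basis"
    have "(h (tilt p b) \<bullet> tilt p b)\<^sup>2 \<le> (\<Sum>l\<in>Basis. (h (tilt p b) \<bullet> tilt p l)\<^sup>2)"
      by (rule member_le_sum) (use b in auto)
    also have "\<dots> = h (tilt p b) \<bullet> h (tilt p b) - (p \<bullet> h (tilt p b))\<^sup>2 / V"
      using sum_tilt_inner[of "h (tilt p b)" p "h (tilt p b)"]
      by (simp add: power2_eq_square V_def)
    finally show "(h (tilt p b) \<bullet> tilt p b)\<^sup>2 \<le> h (tilt p b) \<bullet> h (tilt p b) - (p \<bullet> h (tilt p b))\<^sup>2 / V" .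
  qed
  also have "\<dots> = (\<Sum>b\<in>Basis. h (tilt p b) \<bullet> h (tilt p b)) - V * G"
    using V by (simp add: test(1) sum_subtractf power_mult_distrib power2_eq_square
        sum_divide_distrib[symmetric] sum_distrib_left[symmetric] G_def field_simps)
  finally have CS: "(B (p \<bullet> p))\<^sup>2 / DIM('a) + V * G \<le> (\<Sum>b\<in>Basis. h (tilt p b) \<bullet> h (tilt p b))"
    by simp
  have "(\<Sum>b\<in>Basis. (h (tilt p b) \<bullet> h (tilt p b) + T p (tilt p b) \<bullet> tilt p b) / V
      - 2 * (h p \<bullet> tilt p b)\<^sup>2 / V\<^sup>2 + K (tilt p b) \<bullet> tilt p b) \<le> 0"
    by (rule sum_nonpos) (rule test(2))
  then have sum: "((\<Sum>b\<in>Basis. h (tilt p b) \<bullet> h (tilt p b)) + (\<Sum>b\<in>Basis. T p (tilt p b) \<bullet> tilt p b)) / V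
      - 2 * (\<Sum>b\<in>Basis. (h p \<bullet> tilt p b)\<^sup>2) / V\<^sup>2 + (\<Sum>b\<in>Basis. K (tilt p b) \<bullet> tilt p b) \<le> 0"
    by (simp add: sum.distrib sum_subtractf sum_divide_distrib[symmetric] sum_distrib_left[symmetric])
  \<comment> \<open>After division by \<open>V\<close>, the term \<open>G\<close> occurs once from
    the rows, twice from the differentiated equation and minus twice from differentiating the
    logarithm a second time. One copy survives, which is |grad s|_A^2.\<close>
  have T2: "(\<Sum>b\<in>Basis. T p (tilt p b) \<bullet> tilt p b) = - 2 * B' * V * (s x \<bullet> p) + 2 * V * G"
  proof -
    have "h p \<bullet> h p = V\<^sup>2 * G + V * (s x \<bullet> p)\<^sup>2"
      using sumhp sumhp' V by (simp add: hp[of p] power2_eq_square mult_ac)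
    then have "2 * (h p \<bullet> h p) / V - 2 * (h p \<bullet> p)\<^sup>2 / V\<^sup>2 = 2 * V * G"
      using V by (simp add: hp[of p] power2_eq_square add_divide_distrib distrib_left)
    then show ?thesis
      using sumT by (simp add: hp[of p])
  qed
  have "((B (p \<bullet> p))\<^sup>2 / DIM('a) + V * G) / V \<le> (\<Sum>b\<in>Basis. h (tilt p b) \<bullet> h (tilt p b)) / V"
    using CS V by (intro divide_right_mono) auto
  moreover have "((B (p \<bullet> p))\<^sup>2 / DIM('a) + V * G) / V = (B (p \<bullet> p))\<^sup>2 / (DIM('a) * V) + G"
    using V by (simp add: add_divide_distrib)
  moreover have "((\<Sum>b\<in>Basis. h (tilt p b) \<bullet> h (tilt p b)) + (- 2 * B' * V * (s x \<bullet> p) + 2 * V * G)) / V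
      - 2 * (V\<^sup>2 * G) / V\<^sup>2 = (\<Sum>b\<in>Basis. h (tilt p b) \<bullet> h (tilt p b)) / V - 2 * B' * (s x \<bullet> p)"
    using V by (simp add: add_divide_distrib diff_divide_distrib)
  ultimately show ?thesis
    using sum unfolding T2 sumhp' G_def[symmetric] p_def[symmetric] V_def[symmetric] by linarith
qed

subsection \<open>Derivatives of a solution\<close>

lemma C_k_on_SucD:
  assumes "C_k_on (Suc k) f S"
  shows "x \<in> S \<Longrightarrow> (f has_derivative frechet_derivative f (at x)) (at x)"
    and "C_k_on k (\<lambda>x. frechet_derivative f (at x) v) S"
  using assms by (auto simp: frechet_derivative_works)

lemma has_derivative_grad:
  fixes u :: "real^'n \<Rightarrow> real"
  assumes "u differentiable (at x)"
  shows "(u has_derivative (\<lambda>\<xi>. grad u x \<bullet> \<xi>)) (at x)"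
proof -
  have "frechet_derivative u (at x) \<xi> = grad u x \<bullet> \<xi>" for \<xi> :: "real^'n"
  proof -
    have lin: "linear (frechet_derivative u (at x))"
      using assms by (rule linear_frechet_derivative)
    have "frechet_derivative u (at x) \<xi> = frechet_derivative u (at x) (\<Sum>i\<in>UNIV. (\<xi> $ i) *\<^sub>R axis i 1)"
      using basis_expansion[of \<xi>] by (simp add: scalar_mult_eq_scaleR)
    also have "\<dots> = (\<Sum>i\<in>UNIV. \<xi> $ i * partial i u x)"
      by (simp add: linear_sum[OF lin] linear_scale[OF lin] partial_def)
    finally show ?thesis
      by (simp add: grad_def inner_vec_def mult.commute)
  qed
  then have "frechet_derivative u (at x) = (\<lambda>\<xi>. grad u x \<bullet> \<xi>)" by auto
  then show ?thesis
    using assms by (metis frechet_derivative_works)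
qed

lemma continuous_on_grad:
  assumes "C_k_on 1 u UNIV"
  shows "continuous_on UNIV (grad u)"
  unfolding grad_def partial_def
  using assms by (intro continuous_on_vec_lambda) simp

definition hess :: "(real^'n \<Rightarrow> real) \<Rightarrow> real^'n \<Rightarrow> real^'n \<Rightarrow> real^'n" where
  "hess u x \<xi> = (\<chi> i. frechet_derivative (partial i u) (at x) \<xi>)"

text \<open>The first vector argument is the direction of the last differentiation, in agreement
  with \<open>T\<close> in \<open>bernstein_at_max\<close>.\<close>

definition third :: "(real^'n \<Rightarrow> real) \<Rightarrow> real^'n \<Rightarrow> real^'n \<Rightarrow> real^'n \<Rightarrow> real^'n" where
  "third u x \<eta> \<xi> = (\<chi> i. frechet_derivative (\<lambda>y. frechet_derivative (partial i u) (at y) \<xi>) (at x) \<eta>)"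

lemma has_derivative_vec:
  fixes f :: "'a::euclidean_space \<Rightarrow> real^'n"
  assumes "\<And>i. ((\<lambda>y. f y $ i) has_derivative (\<lambda>\<xi>. f' \<xi> $ i)) (at x)"
  shows "(f has_derivative f') (at x)"
proof (rule has_derivative_componentwise_within[where S = UNIV, THEN iffD2], rule ballI)
  fix b :: "real^'n" assume "b \<in> Basis"
  then obtain i where "b = axis i 1" by (auto simp: Basis_vec_def)
  then show "((\<lambda>y. f y \<bullet> b) has_derivative (\<lambda>\<xi>. f' \<xi> \<bullet> b)) (at x)"
    using assms[of i] by (simp add: inner_axis)
qed

context
  fixes u :: "real^'n \<Rightarrow> real" and S :: "(real^'n) set"
  assumes S: "open S" and u: "C_k_on 3 u S"
begin

lemma C3_partial: "C_k_on 2 (partial i u) S"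
  using C_k_on_SucD(2)[of 2 u S "axis i 1"] u by (simp add: partial_def[abs_def] numeral_3_eq_3 numeral_2_eq_2)

lemma C3_second: "C_k_on 1 (\<lambda>y. frechet_derivative (partial i u) (at y) \<xi>) S"
  using C_k_on_SucD(2)[of 1 "partial i u" S \<xi>] C3_partial by (simp add: numeral_2_eq_2)

lemma C3_third: "continuous_on S (\<lambda>y. frechet_derivative (\<lambda>y. frechet_derivative (partial i u) (at y) \<xi>) (at y) \<eta>)"
  using C_k_on_SucD(2)[of 0 "\<lambda>y. frechet_derivative (partial i u) (at y) \<xi>" S \<eta>] C3_second by simp

lemma C3_has_derivative_grad:
  assumes "y \<in> S"
  shows "(u has_derivative (\<lambda>\<xi>. grad u y \<bullet> \<xi>)) (at y)"
  using u assms by (intro has_derivative_grad) (simp add: numeral_3_eq_3)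

lemma has_derivative_grad_hess:
  assumes "y \<in> S"
  shows "(grad u has_derivative hess u y) (at y)"
  using C_k_on_SucD(1)[of 1 "partial _ u" S] C3_partial assms
  by (intro has_derivative_vec) (simp add: grad_def hess_def numeral_2_eq_2)

lemma has_derivative_hess_third:
  assumes "y \<in> S"
  shows "((\<lambda>y. hess u y \<xi>) has_derivative (\<lambda>\<eta>. third u y \<eta> \<xi>)) (at y)"
  using C_k_on_SucD(1)[of 0 "\<lambda>y. frechet_derivative (partial _ u) (at y) \<xi>" S] C3_second assms
  by (intro has_derivative_vec) (simp add: hess_def third_def)

lemma continuous_on_third: "continuous_on S (\<lambda>y. third u y \<eta> \<xi>)"
  unfolding third_def using C3_third by (intro continuous_on_vec_lambda)

lemma hess_symmetric:
  assumes "y \<in> S"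
  shows "hess u y \<xi> \<bullet> \<eta> = hess u y \<eta> \<bullet> \<xi>"
proof (rule symmetric_second_derivative[OF S assms, of u "\<lambda>y v. grad u y \<bullet> v" "\<lambda>y v w. hess u y w \<bullet> v" \<eta> \<xi>])
  show "continuous_on S (\<lambda>y. hess u y w \<bullet> v)" for v w
    by (intro continuous_intros continuous_at_imp_continuous_on ballI has_derivative_continuous)
      (rule has_derivative_hess_third)
qed (auto intro!: C3_has_derivative_grad has_derivative_grad_hess has_derivative_inner_left)

text \<open>The symmetry of the Hessian is an identity on the open set \<open>S\<close>, so both
  sides have the same derivative.\<close>

lemma third_symmetric_last:
  assumes "y \<in> S"
  shows "third u y \<eta> \<xi> \<bullet> \<zeta> = third u y \<eta> \<zeta> \<bullet> \<xi>"
proof -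
  have *: "((\<lambda>y. hess u y \<xi> \<bullet> \<zeta>) has_derivative (\<lambda>\<eta>. third u y \<eta> \<xi> \<bullet> \<zeta>)) (at y)" for \<xi> \<zeta>
    by (intro has_derivative_inner_left has_derivative_hess_third assms)
  have "((\<lambda>y. hess u y \<xi> \<bullet> \<zeta>) has_derivative (\<lambda>\<eta>. third u y \<eta> \<zeta> \<bullet> \<xi>)) (at y)"
    by (rule has_derivative_transform_within_open[OF *[of \<zeta> \<xi>] S assms]) (rule hess_symmetric)
  from has_derivative_unique[OF *[of \<xi> \<zeta>] this] show ?thesis
    by (rule fun_cong)
qed

text \<open>Schwarz's theorem for the function \<open>grad u y \<bullet> \<zeta>\<close>. This is
  where continuity of the third derivatives, hence the class C^3, enters.\<close>

lemma third_symmetric_first: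
  assumes "y \<in> S"
  shows "third u y \<eta> \<xi> = third u y \<xi> \<eta>"
proof (rule vector_eq_ldot[THEN iffD1], rule allI)
  fix \<zeta>
  have "third u y \<eta> \<xi> \<bullet> \<zeta> = third u y \<xi> \<eta> \<bullet> \<zeta>"
  proof (rule symmetric_second_derivative[OF S assms, of "\<lambda>y. grad u y \<bullet> \<zeta>"
        "\<lambda>y v. hess u y v \<bullet> \<zeta>" "\<lambda>y v w. third u y w v \<bullet> \<zeta>" \<xi> \<eta>])
    show "continuous_on S (\<lambda>y. third u y w v \<bullet> \<zeta>)" for v w
      by (intro continuous_intros continuous_on_third)
  qed (auto intro!: has_derivative_grad_hess has_derivative_hess_third has_derivative_inner_left)
  then show "\<zeta> \<bullet> third u y \<eta> \<xi> = \<zeta> \<bullet> third u y \<xi> \<eta>"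
    by (simp add: inner_commute)
qed

text \<open>Differentiating the factor 1/v contributes -(D^2 u p) / v^3, and multiplication by v
  leaves the trace of A D^2 u. The right-hand side is in the shape of hypothesis \<open>eq\<close>
  of \<open>bernstein_at_max\<close>.\<close>

lemma divergence_mean_curvature:
  assumes "y \<in> S"
  shows "sqrt (1 + grad u y \<bullet> grad u y) *
      divergence (\<lambda>y. (1 / sqrt (1 + (norm (grad u y))\<^sup>2)) *\<^sub>R grad u y) y
    = (\<Sum>b\<in>Basis. hess u y b \<bullet> b) - (hess u y (grad u y) \<bullet> grad u y) / (1 + grad u y \<bullet> grad u y)"
proof -
  define p where "p = grad u y"
  define v where "v = sqrt (1 + p \<bullet> p)"
  have v: "v > 0" "v\<^sup>2 = 1 + p \<bullet> p" by (auto simp: v_def add_pos_nonneg)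
  have "1 + p \<bullet> p > 0" by (simp add: add_pos_nonneg)
  have part: "partial i (\<lambda>y. ((1 / sqrt (1 + (norm (grad u y))\<^sup>2)) *\<^sub>R grad u y) $ i) y
      = (hess u y (axis i 1) $ i) / v - (hess u y p \<bullet> axis i 1) * (p $ i) / v^3" for i
  proof -
    have g: "((\<lambda>y. grad u y $ i) has_derivative (\<lambda>\<xi>. hess u y \<xi> $ i)) (at y)"
      using has_derivative_inner_left[OF has_derivative_grad_hess[OF assms], of "axis i 1"]
      by (simp add: inner_axis)
    have w: "((\<lambda>y. 1 + grad u y \<bullet> grad u y) has_derivative (\<lambda>\<xi>. 2 * (hess u y p \<bullet> \<xi>))) (at y)"
      using has_derivative_add[OF has_derivative_const
          has_derivative_inner[OF has_derivative_grad_hess[OF assms] has_derivative_grad_hess[OF assms]]]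
      by (simp add: p_def[symmetric] inner_commute[of p] hess_symmetric[OF assms, of _ p])
    have r: "((\<lambda>y. sqrt (1 + grad u y \<bullet> grad u y)) has_derivative (\<lambda>\<xi>. (hess u y p \<bullet> \<xi>) / v)) (at y)"
      by (rule has_derivative_eq_rhs[OF has_derivative_real_sqrt[OF _ w]])
        (use \<open>1 + p \<bullet> p > 0\<close> in \<open>auto simp: p_def[symmetric] v_def[symmetric] inverse_eq_divide\<close>)
    have "((\<lambda>y. ((1 / sqrt (1 + (norm (grad u y))\<^sup>2)) *\<^sub>R grad u y) $ i) has_derivative
        (\<lambda>\<xi>. ((hess u y \<xi> $ i) * v - (p $ i) * ((hess u y p \<bullet> \<xi>) / v)) / (v * v))) (at y)"
      using has_derivative_divide'[OF g r] v
      by (simp add: p_def[symmetric] v_def[symmetric] power2_norm_eq_inner)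
    from frechet_derivative_at[OF this, symmetric] show ?thesis
      using v(1) by (simp add: partial_def field_simps power3_eq_cube)
  qed
  have "v * divergence (\<lambda>y. (1 / sqrt (1 + (norm (grad u y))\<^sup>2)) *\<^sub>R grad u y) y
      = (\<Sum>i\<in>UNIV. hess u y (axis i 1) $ i) - (\<Sum>i\<in>UNIV. (hess u y p $ i) * (p $ i)) / v\<^sup>2"
    using v(1) unfolding divergence_def part
    by (simp add: sum_subtractf sum_distrib_left sum_divide_distrib right_diff_distrib inner_axis
        power3_eq_cube power2_eq_square mult_ac)
  also have "(\<Sum>i\<in>UNIV. (hess u y p $ i) * (p $ i)) = hess u y p \<bullet> p"
    by (simp add: inner_vec_def)
  also have "(\<Sum>i\<in>UNIV. hess u y (axis i 1) $ i) = (\<Sum>b\<in>Basis. hess u y b \<bullet> b)"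
  proof -
    have inj: "inj (\<lambda>i. axis i (1::real) :: real^'n)" by (auto simp: inj_on_def axis_eq_axis)
    have "(Basis :: (real^'n) set) = (\<lambda>i. axis i 1) ` UNIV" by (auto simp: Basis_vec_def)
    then show ?thesis
      using sum.reindex[OF inj, of "\<lambda>b. hess u y b \<bullet> b"] by (simp add: inner_axis)
  qed
  finally show ?thesis
    using v by (simp add: v_def p_def)
qed

end

subsection \<open>Barriers\<close>

text \<open>The barrier tends to minus infinity where \<open>\<phi>\<close> tends to 0, so the
  supremum over the set where \<open>\<phi>\<close> is positive, which need not be compact, is
  attained on a compact superlevel set.\<close>

lemma barrier_max_exists:
  fixes w \<phi> :: "'a::euclidean_space \<Rightarrow> real"
  assumes w: "continuous_on (cball a R) w" and \<phi>: "continuous_on (cball a R) \<phi>"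
    and "R > 0" "m \<noteq> 0" and pos: "\<phi> a > 0" and bdry: "\<And>y. y \<in> sphere a R \<Longrightarrow> \<phi> y \<le> 0"
  obtains x where "x \<in> ball a R" "\<phi> x > 0"
    "\<And>y. y \<in> ball a R \<Longrightarrow> \<phi> y > 0 \<Longrightarrow> w y - 1 / \<phi> y ^ m \<le> w x - 1 / \<phi> x ^ m"
proof -
  have a: "a \<in> cball a R" using \<open>R > 0\<close> by simp
  obtain M where M: "\<And>y. y \<in> cball a R \<Longrightarrow> w y \<le> M"
    using continuous_attains_sup[OF compact_cball _ w] a by blast
  \<comment> \<open>With this \<open>A\<close>, a barrier of size at least \<open>A\<close> forces a
    value below the one at \<open>a\<close>. Below \<open>\<delta> \<le> 1 / A \<le> 1\<close> the
    power of \<open>\<phi>\<close> is at most \<open>\<phi>\<close> itself, so the barrier is that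
    large there; \<open>\<delta> \<le> \<phi> a\<close> keeps \<open>a\<close> in the compact
    set.\<close>
  define A where "A = M - w a + 1 / \<phi> a ^ m + 1"
  have A: "A \<ge> 1" using M[OF a] pos by (simp add: A_def)
  define \<delta> where "\<delta> = min (\<phi> a) (1 / A)"
  have \<delta>: "\<delta> > 0" "\<delta> \<le> \<phi> a" "\<delta> \<le> 1 / A" using A pos by (auto simp: \<delta>_def)
  define C where "C = cball a R \<inter> \<phi> -` {\<delta>..}"
  have "compact C"
    unfolding C_def compact_eq_bounded_closed
    using continuous_closed_preimage[OF \<phi> closed_cball closed_atLeast]
    by (auto intro: bounded_subset[OF bounded_cball])
  moreover have aC: "a \<in> C" using a \<delta> by (simp add: C_def)
  moreover have "continuous_on C (\<lambda>y. w y - 1 / \<phi> y ^ m)"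
    using \<delta>(1) by (intro continuous_intros continuous_on_subset[OF w] continuous_on_subset[OF \<phi>])
      (auto simp: C_def)
  ultimately obtain x where x: "x \<in> C" "\<And>y. y \<in> C \<Longrightarrow> w y - 1 / \<phi> y ^ m \<le> w x - 1 / \<phi> x ^ m"
    using continuous_attains_sup[of C "\<lambda>y. w y - 1 / \<phi> y ^ m"] by blast
  show thesis
  proof
    show "\<phi> x > 0" using x \<delta> by (simp add: C_def)
    then show "x \<in> ball a R" using x(1) bdry[of x] by (force simp: C_def)
    fix y assume y: "y \<in> ball a R" "\<phi> y > 0"
    show "w y - 1 / \<phi> y ^ m \<le> w x - 1 / \<phi> x ^ m"
    proof (cases "\<delta> \<le> \<phi> y")
      case True
      then show ?thesis using x(2)[of y] y by (simp add: C_def)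
    next
      case False
      then have "\<phi> y < 1 / A" using \<delta> by simp
      moreover have "1 / A \<le> 1" using A by simp
      ultimately have "\<phi> y ^ m \<le> \<phi> y" using y \<open>m \<noteq> 0\<close> power_decreasing[of 1 m "\<phi> y"] by simp
      then have "1 / \<phi> y \<le> 1 / \<phi> y ^ m" using y by (intro divide_left_mono) auto
      moreover have "A < 1 / \<phi> y" using \<open>\<phi> y < 1 / A\<close> A y by (simp add: less_divide_eq mult.commute)
      ultimately have "A \<le> 1 / \<phi> y ^ m" by linarith
      then have "w y - 1 / \<phi> y ^ m \<le> M - A" using M[of y] y by simp
      also have "\<dots> \<le> w a - 1 / \<phi> a ^ m" by (simp add: A_def)
      also have "\<dots> \<le> w x - 1 / \<phi> x ^ m" by (rule x(2)[OF aC])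
      finally show ?thesis .
    qed
  qed
qed

lemma DERIV_inverse_power:
  assumes "(t::real) \<noteq> 0"
  shows "((\<lambda>t. 1 / t ^ k) has_real_derivative - (k / t ^ (k + 1))) (at t)"
proof (cases k)
  case (Suc j)
  show ?thesis
    using DERIV_divide[OF DERIV_const[of 1] DERIV_pow[of "Suc j" t]] assms
    by (simp add: Suc power2_eq_square divide_simps)
qed simp

lemma has_derivative_barrier:
  fixes \<phi> :: "'a::real_inner \<Rightarrow> real"
  assumes \<phi>: "(\<phi> has_derivative (\<lambda>\<xi>. z x \<bullet> \<xi>)) (at x)" and nz: "\<phi> x \<noteq> 0"
  shows "((\<lambda>y. - (1 / \<phi> y ^ m)) has_derivative (\<lambda>\<xi>. ((real m / \<phi> x ^ (m + 1)) *\<^sub>R z x) \<bullet> \<xi>)) (at x)"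
proof -
  have "((\<lambda>y. - (1 / \<phi> y ^ m)) has_derivative (\<lambda>\<xi>. - ((z x \<bullet> \<xi>) * - (real m / \<phi> x ^ (m + 1))))) (at x)"
    by (rule has_derivative_minus, rule DERIV_compose_FDERIV[where f = "\<lambda>t. 1 / t ^ m"],
        rule DERIV_inverse_power[OF nz], rule \<phi>)
  moreover have "- ((z x \<bullet> \<xi>) * - (real m / \<phi> x ^ (m + 1))) = ((real m / \<phi> x ^ (m + 1)) *\<^sub>R z x) \<bullet> \<xi>" for \<xi>
    by simp
  ultimately show ?thesis by (simp only:)
qed

lemma has_derivative_grad_barrier:
  fixes \<phi> :: "'a::real_inner \<Rightarrow> real" and z :: "'a \<Rightarrow> 'a"
  assumes \<phi>: "(\<phi> has_derivative (\<lambda>\<xi>. z x \<bullet> \<xi>)) (at x)" and nz: "\<phi> x \<noteq> 0"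
    and z: "(z has_derivative Z) (at x)"
  shows "((\<lambda>y. (real m / \<phi> y ^ (m + 1)) *\<^sub>R z y) has_derivative
    (\<lambda>\<xi>. (real m / \<phi> x ^ (m + 1)) *\<^sub>R Z \<xi> - (real m * real (m + 1) / \<phi> x ^ (m + 2) * (z x \<bullet> \<xi>)) *\<^sub>R z x)) (at x)"
proof -
  have "((\<lambda>y. real m * (1 / \<phi> y ^ (m + 1))) has_derivative
      (\<lambda>\<xi>. real m * ((z x \<bullet> \<xi>) * - (real (m + 1) / \<phi> x ^ (m + 1 + 1))))) (at x)"
    by (rule has_derivative_mult_right, rule DERIV_compose_FDERIV[where f = "\<lambda>t. 1 / t ^ (m + 1)"],
        rule DERIV_inverse_power[OF nz], rule \<phi>)
  from has_derivative_scaleR[OF this z] show ?thesis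
    by (simp add: mult_ac)
qed

text \<open>The source v F(|p|) is treated as a function of w = |p|^2, so that the chain rule meets
  the smooth function \<open>g y \<bullet> g y\<close> instead of a norm. Twice this derivative is
  the coefficient \<open>\<beta>\<close> of the drift.\<close>

lemma DERIV_sqrt_mult_comp_sqrt:
  assumes F: "(F has_real_derivative d) (at q)" and q: "(q::real) > 0"
  shows "((\<lambda>w. sqrt (1 + w) * F (sqrt w)) has_real_derivative
    (F q / sqrt (1 + q\<^sup>2) + sqrt (1 + q\<^sup>2) * d / q) / 2) (at (q\<^sup>2))"
proof -
  have qq: "sqrt (q\<^sup>2) = q" using q by simp
  have "((\<lambda>w. F (sqrt w)) has_real_derivative d * (inverse (sqrt (q\<^sup>2)) / 2)) (at (q\<^sup>2))"
    by (rule DERIV_chain2[where f = F and g = sqrt])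
      (subst qq, rule F, rule DERIV_real_sqrt, use q in simp)
  moreover have "((\<lambda>w. sqrt (1 + w)) has_real_derivative inverse (sqrt (1 + q\<^sup>2)) / 2 * (0 + 1)) (at (q\<^sup>2))"
    by (rule DERIV_chain2[where f = sqrt and g = "\<lambda>w. 1 + w"])
      (rule DERIV_real_sqrt, simp add: add_pos_nonneg, rule DERIV_add, rule DERIV_const, rule DERIV_ident)
  ultimately have der: "((\<lambda>w. sqrt (1 + w) * F (sqrt w)) has_real_derivative
      inverse (sqrt (1 + q\<^sup>2)) / 2 * (0 + 1) * F (sqrt (q\<^sup>2))
      + d * (inverse (sqrt (q\<^sup>2)) / 2) * sqrt (1 + q\<^sup>2)) (at (q\<^sup>2))"
    by (rule DERIV_mult[rotated])
  have "inverse v / 2 * (0 + 1) * b + d * (inverse q / 2) * v = (b / v + v * d / q) / 2"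
    if "v > 0" for v b :: real
    using q that by (simp add: field_simps)
  from this[of "sqrt (1 + q\<^sup>2)"] show ?thesis
    by (intro DERIV_cong[OF der[unfolded qq]]) (simp add: add_pos_nonneg)
qed

lemma sum_tilt_self:
  fixes p :: "'a::euclidean_space"
  shows "(\<Sum>b\<in>Basis. tilt p b \<bullet> tilt p b) \<le> DIM('a)"
proof -
  have "p \<bullet> p / (1 + p \<bullet> p) \<ge> 0" by (simp add: add_nonneg_nonneg)
  then show ?thesis
    using sum_tilt_linear[OF linear_id, of p] by simp
qed

text \<open>With b = F(q), d = F'(q) and \<open>\<beta>\<close> = b/v + v d/q, the drift is
  \<open>\<beta>\<close> p. The first identity measures its size, which matters for the cutoff; the
  second is L u = tr (A D^2 u) - \<open>\<beta>\<close> |p|^2.\<close>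

lemma radial_derivative_identities:
  fixes q v b d :: real
  assumes "q > 0" "v > 0" and v: "v\<^sup>2 = 1 + q\<^sup>2"
  shows "(b / v + v * d / q) * q = q * b / v + v * d"
    and "v * b - (b / v + v * d / q) * q\<^sup>2 = b / v - q * v * d"
proof -
  show 1: "(b / v + v * d / q) * q = q * b / v + v * d"
    using assms(1,2) by (simp add: field_simps)
  have "(b / v + v * d / q) * q\<^sup>2 = (q * b / v + v * d) * q"
    unfolding 1[symmetric] by (simp add: power2_eq_square)
  also have "\<dots> = q\<^sup>2 * b / v + q * v * d"
    by (simp add: power2_eq_square algebra_simps)
  finally have 2: "(b / v + v * d / q) * q\<^sup>2 = q\<^sup>2 * b / v + q * v * d" .
  have "v * b = v\<^sup>2 * b / v"
    using assms(2) by (simp add: power2_eq_square)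
  then have "v * b = b / v + q\<^sup>2 * b / v"
    unfolding v by (simp add: distrib_right add_divide_distrib)
  then show "v * b - (b / v + v * d / q) * q\<^sup>2 = b / v - q * v * d"
    using 2 by linarith
qed

text \<open>This is \<open>bernstein_at_max\<close> for s = -1/phi^m, with the maximum point reduced
  to three numbers: \<open>q\<close> is |grad u|, \<open>t\<close> is phi and \<open>G\<close> is
  |grad phi|_A^2 there. The factors \<open>m / t ^ (m + 1)\<close> and
  \<open>real m * real (m + 1) / t ^ (m + 2)\<close> are the first derivative and minus the second
  derivative of -1/t^m. The bracket is a lower bound of L phi: mu times L u, less the trace and the
  drift of the cutoff.\<close>

lemma solution_max_principle:
  fixes u :: "real^'n \<Rightarrow> real" and F F' :: "real \<Rightarrow> real" and m :: nat
  assumes sol: "entire_solution (\<lambda>p. F (norm p)) u"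
    and F: "\<And>q. q > 0 \<Longrightarrow> (F has_real_derivative F' q) (at q)"
    and R: "R > 0" and m: "m \<noteq> 0"
    and \<epsilon>: "\<epsilon> < 1/8" "\<And>y. y \<in> cball a R \<Longrightarrow> \<bar>\<mu> * u y\<bar> \<le> \<epsilon>"
    and start: "1 / (1/4 - 2 * \<epsilon>) ^ m - 4 ^ m < ln (1 + (norm (grad u a))\<^sup>2) / 2"
  obtains q t G where "q > 0" "0 < t" "t \<le> 1/4"
    "ln (1 + (norm (grad u a))\<^sup>2) / 2 - 1 / (1/4 - 2 * \<epsilon>) ^ m + 1 / t ^ m \<le> ln (1 + q\<^sup>2) / 2"
    "G \<ge> 0" "G \<ge> \<mu>\<^sup>2 * (q\<^sup>2 / (1 + q\<^sup>2)) / 2 - 1 / (4 * R\<^sup>2)"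
    "(F q)\<^sup>2 / CARD('n) + (m / t ^ (m + 1)) *
       (\<mu> * (F q / sqrt (1 + q\<^sup>2) - q * sqrt (1 + q\<^sup>2) * F' q) - CARD('n) / (2 * R\<^sup>2)
         - \<bar>q * F q / sqrt (1 + q\<^sup>2) + sqrt (1 + q\<^sup>2) * F' q\<bar> / (2 * R))
      + ((m / t ^ (m + 1))\<^sup>2 - real m * real (m + 1) / t ^ (m + 2)) * G \<le> 0"
proof -
  define S where "S = {x. norm (grad u x) > 0}"
  have u1: "C_k_on 1 u UNIV" and u3: "C_k_on 3 u S"
    and pde: "\<And>x. x \<in> S \<Longrightarrow>
      divergence (\<lambda>y. (1 / sqrt (1 + (norm (grad u y))\<^sup>2)) *\<^sub>R grad u y) x = F (norm (grad u x))"
    using sol by (auto simp: entire_solution_def S_def)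
  have cg: "continuous_on UNIV (grad u)" using u1 by (rule continuous_on_grad)
  have "open S"
    unfolding S_def by (intro open_Collect_less continuous_intros cg)
  have du: "(u has_derivative (\<lambda>\<xi>. grad u y \<bullet> \<xi>)) (at y)" for y
    using u1 by (intro has_derivative_grad) simp
  have cu: "continuous_on UNIV u"
    by (intro continuous_at_imp_continuous_on ballI has_derivative_continuous[OF du])
  \<comment> \<open>Since |mu u| is at most \<open>\<epsilon>\<close> on the ball, subtracting
    \<open>\<epsilon>\<close> gives \<open>\<phi>\<close> at most 0 on the sphere and at most 1/4
    inside, at the price of a value at \<open>a\<close> that may drop to
    \<open>1/4 - 2 * \<epsilon>\<close>.\<close>
  define \<phi> where "\<phi> = (\<lambda>y. (1 - ((y - a) \<bullet> (y - a)) / R\<^sup>2) / 4 + \<mu> * u y - \<epsilon>)"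
  define w where "w = (\<lambda>y. ln (1 + grad u y \<bullet> grad u y) / 2)"
  have pos: "1 + z \<bullet> z > 0" for z :: "real^'n" by (simp add: add_pos_nonneg)
  have cw: "continuous_on UNIV w"
    unfolding w_def using pos by (intro continuous_intros cg) (auto simp: less_imp_neq[symmetric])
  have c\<phi>: "continuous_on UNIV \<phi>"
    unfolding \<phi>_def using R by (intro continuous_intros cu) auto
  have \<phi>a: "\<phi> a \<ge> 1/4 - 2 * \<epsilon>" using \<epsilon>(2)[of a] R by (simp add: \<phi>_def)
  have \<phi>_le: "\<phi> y \<le> 1/4" if "y \<in> cball a R" for y
  proof -
    define X where "X = ((y - a) \<bullet> (y - a)) / R\<^sup>2"
    have "X \<ge> 0" by (simp add: X_def)
    then show ?thesis using \<epsilon>(2)[OF that] unfolding \<phi>_def X_def[symmetric] diff_divide_distrib by linarith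
  qed
  obtain x where x: "x \<in> ball a R" "\<phi> x > 0"
    and max: "\<And>y. y \<in> ball a R \<Longrightarrow> \<phi> y > 0 \<Longrightarrow> w y - 1 / \<phi> y ^ m \<le> w x - 1 / \<phi> x ^ m"
  proof (rule barrier_max_exists[of a R w \<phi> m])
    show "\<phi> a > 0" using \<phi>a \<epsilon>(1) by linarith
    fix y assume y: "y \<in> sphere a R"
    then have "(y - a) \<bullet> (y - a) = R\<^sup>2"
      by (simp add: dot_square_norm dist_norm norm_minus_commute)
    then show "\<phi> y \<le> 0" using \<epsilon>(2)[of y] y R by (simp add: \<phi>_def)
  qed (use R m in \<open>auto intro: continuous_on_subset[OF cw] continuous_on_subset[OF c\<phi>]\<close>)
  define p where "p = grad u x"
  define q where "q = norm p"
  define t where "t = \<phi> x"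
  define v where "v = sqrt (1 + q\<^sup>2)"
  have q2: "p \<bullet> p = q\<^sup>2" by (simp add: q_def dot_square_norm)
  have v: "v > 0" "v\<^sup>2 = 1 + q\<^sup>2" by (auto simp: v_def add_pos_nonneg)
  have t: "0 < t" "t \<le> 1/4" using x \<phi>_le[of x] by (auto simp: t_def)
  have t4: "4 ^ m \<le> 1 / t ^ m"
    using power_mono[of t "1/4" m] t by (simp add: field_simps power_one_over)
  have "1 / \<phi> a ^ m \<le> 1 / (1/4 - 2 * \<epsilon>) ^ m"
    using \<phi>a \<epsilon>(1) by (intro divide_left_mono power_mono mult_pos_pos zero_less_power) auto
  then have hq: "ln (1 + (norm (grad u a))\<^sup>2) / 2 - 1 / (1/4 - 2 * \<epsilon>) ^ m + 1 / t ^ m \<le> ln (1 + q\<^sup>2) / 2"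
    using max[of a] R \<phi>a \<epsilon>(1)
    by (simp add: w_def t_def dot_square_norm q_def p_def) 
  \<comment> \<open>\<open>start\<close> covers the worst case,
    \<open>\<phi> a = 1/4 - 2 * \<epsilon>\<close> against \<open>t = 1/4\<close>. The maximum is
    therefore not a critical point of \<open>u\<close>, and the equation holds around it.\<close>
  then have "ln (1 + q\<^sup>2) > 0" using start t4 by linarith
  then have "q\<^sup>2 \<noteq> 0" by auto
  then have q: "q > 0" by (simp add: q_def)
  have xS: "x \<in> S" using q by (simp add: S_def q_def p_def)
  note grad_hess = has_derivative_grad_hess[OF \<open>open S\<close> u3]
  define z where "z = (\<lambda>y. \<mu> *\<^sub>R grad u y - (1 / (2 * R\<^sup>2)) *\<^sub>R (y - a))"
  define S' where "S' = {y. \<phi> y > 0} \<inter> S \<inter> ball a R"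
  have S': "open S'" "x \<in> S'"
    using \<open>open S\<close> xS x open_Collect_less[OF continuous_on_const c\<phi>, of 0]
    by (auto simp: S'_def)
  have d\<phi>: "(\<phi> has_derivative (\<lambda>\<xi>. z y \<bullet> \<xi>)) (at y)" for y
  proof -
    have lin: "((\<lambda>y. y - a) has_derivative (\<lambda>\<xi>. \<xi>)) (at y)"
      by (auto intro!: derivative_eq_intros)
    have sq: "((\<lambda>y. (y - a) \<bullet> (y - a)) has_derivative (\<lambda>\<xi>. 2 * ((y - a) \<bullet> \<xi>))) (at y)"
      using has_derivative_inner[OF lin lin] by (simp add: inner_commute)
    have eq: "\<phi> = (\<lambda>y. (1 / 4 - \<epsilon>) - (1 / (4 * R\<^sup>2)) * ((y - a) \<bullet> (y - a)) + \<mu> * u y)"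
      by (simp add: \<phi>_def fun_eq_iff diff_divide_distrib)
    have "(\<phi> has_derivative (\<lambda>\<xi>. 0 - (1 / (4 * R\<^sup>2)) * (2 * ((y - a) \<bullet> \<xi>)) + \<mu> * (grad u y \<bullet> \<xi>))) (at y)"
      unfolding eq
      by (rule has_derivative_add, rule has_derivative_diff, rule has_derivative_const,
          rule has_derivative_mult_right, rule sq, rule has_derivative_mult_right, rule du)
    moreover have "0 - (1 / (4 * R\<^sup>2)) * (2 * ((y - a) \<bullet> \<xi>)) + \<mu> * (grad u y \<bullet> \<xi>) = z y \<bullet> \<xi>" for \<xi>
      by (simp add: z_def inner_diff_left[of "\<mu> *\<^sub>R grad u y"])
    ultimately show ?thesis by simp
  qed
  define B where "B = (\<lambda>w. sqrt (1 + w) * F (sqrt w))"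
  define \<beta> where "\<beta> = F q / v + v * F' q / q"
  define k1 where "k1 = m / t ^ (m + 1)"
  define k2 where "k2 = real m * real (m + 1) / t ^ (m + 2)"
  have k1: "k1 > 0" using m t by (simp add: k1_def)
  define K where "K = (\<lambda>\<xi>. k1 *\<^sub>R (\<mu> *\<^sub>R hess u x \<xi> - (1 / (2 * R\<^sup>2)) *\<^sub>R \<xi>) - (k2 * (z x \<bullet> \<xi>)) *\<^sub>R z x)"
  have "(B (grad u x \<bullet> grad u x))\<^sup>2 / (DIM(real^'n) * (1 + grad u x \<bullet> grad u x))
    + (\<Sum>b\<in>Basis. K (tilt (grad u x) b) \<bullet> tilt (grad u x) b)
    - 2 * (\<beta> / 2) * (((m / \<phi> x ^ (m + 1)) *\<^sub>R z x) \<bullet> grad u x)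
    + (\<Sum>b\<in>Basis. (((m / \<phi> x ^ (m + 1)) *\<^sub>R z x) \<bullet> tilt (grad u x) b)\<^sup>2) \<le> 0"
  proof (rule bernstein_at_max[OF S', where H = "hess u" and T = "third u x" and \<sigma> = "\<lambda>y. - (1 / \<phi> y ^ m)"])
    show "(grad u has_derivative hess u y) (at y)" if "y \<in> S'" for y
      using grad_hess that by (simp add: S'_def)
    show "((\<lambda>y. hess u y \<xi>) has_derivative (\<lambda>\<eta>. third u x \<eta> \<xi>)) (at x)" for \<xi>
      by (rule has_derivative_hess_third[OF \<open>open S\<close> u3 xS])
    show "hess u y \<xi> \<bullet> \<eta> = hess u y \<eta> \<bullet> \<xi>" if "y \<in> S'" for y \<xi> \<eta>
      using hess_symmetric[OF \<open>open S\<close> u3] that by (simp add: S'_def)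
    show "third u x \<eta> \<xi> \<bullet> \<zeta> = third u x \<eta> \<zeta> \<bullet> \<xi>" for \<xi> \<eta> \<zeta>
      by (rule third_symmetric_last[OF \<open>open S\<close> u3 xS])
    show "third u x \<eta> \<xi> = third u x \<xi> \<eta>" for \<xi> \<eta>
      by (rule third_symmetric_first[OF \<open>open S\<close> u3 xS])
    show "(\<Sum>b\<in>Basis. hess u y b \<bullet> b) - hess u y (grad u y) \<bullet> grad u y / (1 + grad u y \<bullet> grad u y)
        = B (grad u y \<bullet> grad u y)" if "y \<in> S'" for y
      using divergence_mean_curvature[OF \<open>open S\<close> u3, of y] pde[of y] that
      by (simp add: B_def S'_def norm_eq_sqrt_inner)
    show "(B has_real_derivative \<beta> / 2) (at (grad u x \<bullet> grad u x))"
      using DERIV_sqrt_mult_comp_sqrt[OF F[OF q] q]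
      unfolding p_def[symmetric] q2 B_def \<beta>_def v_def .
    show "((\<lambda>y. - (1 / \<phi> y ^ m)) has_derivative (\<lambda>\<xi>. ((m / \<phi> y ^ (m + 1)) *\<^sub>R z y) \<bullet> \<xi>)) (at y)"
      if "y \<in> S'" for y
      by (rule has_derivative_barrier[OF d\<phi>]) (use that in \<open>auto simp: S'_def\<close>)
    have "(z has_derivative (\<lambda>\<xi>. \<mu> *\<^sub>R hess u x \<xi> - (1 / (2 * R\<^sup>2)) *\<^sub>R \<xi>)) (at x)"
      unfolding z_def
      by (rule has_derivative_diff, rule has_derivative_scaleR_right, rule grad_hess[OF xS],
          rule has_derivative_scaleR_right) (auto intro!: derivative_eq_intros)
    from has_derivative_grad_barrier[OF d\<phi> _ this]
    show "((\<lambda>y. (m / \<phi> y ^ (m + 1)) *\<^sub>R z y) has_derivative K) (at x)"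
      using x(2) unfolding K_def k1_def k2_def t_def by simp
    show "ln (1 + grad u y \<bullet> grad u y) / 2 + - (1 / \<phi> y ^ m) \<le> ln (1 + grad u x \<bullet> grad u x) / 2 + - (1 / \<phi> x ^ m)"
      if "y \<in> S'" for y
      using max[of y] that by (simp add: S'_def w_def)
  qed
  then have main: "(B (p \<bullet> p))\<^sup>2 / (CARD('n) * (1 + p \<bullet> p)) + (\<Sum>b\<in>Basis. K (tilt p b) \<bullet> tilt p b)
    - \<beta> * (k1 * (z x \<bullet> p)) + (\<Sum>b\<in>Basis. (k1 * (z x \<bullet> tilt p b))\<^sup>2) \<le> 0"
    by (simp add: p_def k1_def t_def)
  define G where "G = (\<Sum>b\<in>Basis. (z x \<bullet> tilt p b)\<^sup>2)"
  define D where "D = (\<Sum>b\<in>(Basis::(real^'n) set). tilt p b \<bullet> tilt p b)"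
  have D: "D \<le> CARD('n)" unfolding D_def using sum_tilt_self[of p] by simp
  have B: "B (p \<bullet> p) = v * F q" using q by (simp add: B_def q2 v_def)
  have H: "(\<Sum>b\<in>Basis. hess u x (tilt p b) \<bullet> tilt p b) = v * F q"
    using sum_tilt_linear[of "hess u x" p] has_derivative_linear[OF grad_hess[OF xS]]
      divergence_mean_curvature[OF \<open>open S\<close> u3 xS] pde[OF xS]
    by (simp add: p_def[symmetric] q_def[symmetric] q2 v_def)
  have sumK: "(\<Sum>b\<in>Basis. K (tilt p b) \<bullet> tilt p b) = k1 * (\<mu> * (v * F q) - D / (2 * R\<^sup>2)) - k2 * G"
  proof -
    have "K \<xi> \<bullet> \<xi> = k1 * (\<mu> * (hess u x \<xi> \<bullet> \<xi>) - (\<xi> \<bullet> \<xi>) / (2 * R\<^sup>2)) - k2 * (z x \<bullet> \<xi>)\<^sup>2" for \<xi>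
      by (simp add: K_def inner_diff_left power2_eq_square)
    then have "(\<Sum>b\<in>Basis. K (tilt p b) \<bullet> tilt p b)
        = k1 * (\<mu> * (\<Sum>b\<in>Basis. hess u x (tilt p b) \<bullet> tilt p b) - D / (2 * R\<^sup>2)) - k2 * G"
      by (simp add: sum_subtractf sum_distrib_left[symmetric] sum_divide_distrib[symmetric] G_def D_def)
    then show ?thesis by (simp only: H)
  qed
  \<comment> \<open>The cutoff has gradient -(x - a) / (2 R^2), of length at most 1 / (2 R) on the
    ball, so the drift meets it with at most |\<open>\<beta>\<close> q| / (2 R).\<close>
  have zp: "\<beta> * (z x \<bullet> p) \<le> \<mu> * \<beta> * q\<^sup>2 + \<bar>\<beta> * q\<bar> / (2 * R)"
  proof -
    have "\<bar>(x - a) \<bullet> p\<bar> \<le> R * q"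
      using Cauchy_Schwarz_ineq2[of "x - a" p] x(1) mult_right_mono[of "norm (x - a)" R q]
      by (simp add: q_def dist_norm norm_minus_commute)
    then have "\<bar>\<beta>\<bar> * \<bar>(x - a) \<bullet> p\<bar> \<le> \<bar>\<beta>\<bar> * (R * q)" by (intro mult_left_mono) auto
    then have "\<bar>\<beta> * ((x - a) \<bullet> p)\<bar> / (2 * R\<^sup>2) \<le> \<bar>\<beta>\<bar> * (R * q) / (2 * R\<^sup>2)"
      by (intro divide_right_mono) (auto simp: abs_mult)
    also have "\<dots> = \<bar>\<beta> * q\<bar> / (2 * R)" using R q by (simp add: abs_mult power2_eq_square)
    finally have le: "\<bar>\<beta> * ((x - a) \<bullet> p)\<bar> / (2 * R\<^sup>2) \<le> \<bar>\<beta> * q\<bar> / (2 * R)" .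
    have "- (\<beta> * ((x - a) \<bullet> p)) / (2 * R\<^sup>2) \<le> \<bar>\<beta> * ((x - a) \<bullet> p)\<bar> / (2 * R\<^sup>2)"
      by (rule divide_right_mono) auto
    moreover have "z x \<bullet> p = \<mu> * q\<^sup>2 - ((x - a) \<bullet> p) / (2 * R\<^sup>2)"
      by (simp add: z_def p_def[symmetric] inner_diff_left[of "\<mu> *\<^sub>R p"] q2)
    then have "\<beta> * (z x \<bullet> p) = \<mu> * \<beta> * q\<^sup>2 + - (\<beta> * ((x - a) \<bullet> p)) / (2 * R\<^sup>2)"
      by (simp add: right_diff_distrib)
    ultimately show ?thesis using le by linarith
  qed
  have \<beta>q: "\<beta> * q = q * F q / v + v * F' q" and \<beta>q2: "v * F q - \<beta> * q\<^sup>2 = F q / v - q * v * F' q"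
    unfolding \<beta>_def using radial_derivative_identities[OF q v] by simp_all
  have sq: "(B (p \<bullet> p))\<^sup>2 / (CARD('n) * (1 + p \<bullet> p)) = (F q)\<^sup>2 / CARD('n)"
    using v unfolding B unfolding q2 v(2)[symmetric] by (simp add: power_mult_distrib)
  have G0: "G \<ge> 0" by (simp add: G_def sum_nonneg)
  have "(F q)\<^sup>2 / CARD('n) + k1 * (\<mu> * (v * F q) - D / (2 * R\<^sup>2) - \<beta> * (z x \<bullet> p)) + (k1\<^sup>2 - k2) * G \<le> 0"
    using main unfolding sq sumK
    by (simp add: G_def power_mult_distrib sum_distrib_left[symmetric] algebra_simps)
  moreover have "k1 * (\<mu> * (F q / v - q * v * F' q) - CARD('n) / (2 * R\<^sup>2) - \<bar>\<beta> * q\<bar> / (2 * R))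
      \<le> k1 * (\<mu> * (v * F q) - D / (2 * R\<^sup>2) - \<beta> * (z x \<bullet> p))"
  proof -
    have "D / (2 * R\<^sup>2) \<le> CARD('n) / (2 * R\<^sup>2)" using D by (intro divide_right_mono) auto
    moreover have "\<mu> * (F q / v - q * v * F' q) = \<mu> * (v * F q) - \<mu> * \<beta> * q\<^sup>2"
      unfolding \<beta>q2[symmetric] by (simp add: algebra_simps)
    ultimately show ?thesis using k1 zp by (intro mult_left_mono) auto
  qed
  ultimately have fin: "(F q)\<^sup>2 / CARD('n) + k1 * (\<mu> * (F q / v - q * v * F' q) - CARD('n) / (2 * R\<^sup>2)
      - \<bar>q * F q / v + v * F' q\<bar> / (2 * R)) + (k1\<^sup>2 - k2) * G \<le> 0"
    unfolding \<beta>q by linarith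
  \<comment> \<open>The gradient of \<open>\<phi>\<close> is mu p minus a cutoff part of length at
    most 1 / (2 R). From (c - d)^2 >= c^2 / 2 - d^2 half of |mu p|_A^2 remains; A shrinks the
    direction of p, so |p|_A^2 is only q^2 / (1 + q^2).\<close>
  have Gge: "G \<ge> \<mu>\<^sup>2 * (q\<^sup>2 / (1 + q\<^sup>2)) / 2 - 1 / (4 * R\<^sup>2)"
  proof -
    define y where "y = (1 / (2 * R\<^sup>2)) *\<^sub>R (x - a)"
    have "(c - d)\<^sup>2 \<ge> c\<^sup>2 / 2 - d\<^sup>2" for c d :: real
      using zero_le_power2[of "c - 2 * d"] by (simp add: power2_eq_square algebra_simps)
    then have "G \<ge> (\<Sum>b\<in>Basis. (\<mu> * (p \<bullet> tilt p b))\<^sup>2 / 2 - (y \<bullet> tilt p b)\<^sup>2)"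
      unfolding G_def by (intro sum_mono) (simp add: z_def y_def[symmetric] p_def[symmetric] inner_diff_left)
    moreover have "(\<Sum>b\<in>Basis. (p \<bullet> tilt p b)\<^sup>2) = q\<^sup>2 / (1 + q\<^sup>2)"
    proof -
      have "s - s * s / (1 + s) = s / (1 + s)" if "s \<ge> 0" for s :: real
        using that by (simp add: field_simps)
      from this[of "q\<^sup>2"] show ?thesis
        using sum_tilt_inner[of p p p] by (simp add: q2 power2_eq_square[of "_ \<bullet> _"])
    qed
    moreover have "(\<Sum>b\<in>Basis. (y \<bullet> tilt p b)\<^sup>2) \<le> 1 / (4 * R\<^sup>2)"
    proof -
      have "(\<Sum>b\<in>Basis. (y \<bullet> tilt p b)\<^sup>2) \<le> y \<bullet> y"
        using sum_tilt_inner[of y p y] pos[of p] by (simp add: power2_eq_square)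
      also have "\<dots> = (norm y)\<^sup>2" by (simp add: dot_square_norm)
      also have "\<dots> \<le> (1 / (2 * R))\<^sup>2"
      proof (rule power_mono)
        have "norm (x - a) / (2 * R\<^sup>2) \<le> R / (2 * R\<^sup>2)"
          using x(1) by (intro divide_right_mono) (auto simp: dist_norm norm_minus_commute)
        then show "norm y \<le> 1 / (2 * R)" using R by (simp add: y_def power2_eq_square)
      qed simp
      finally show ?thesis by (simp add: power_divide power_mult_distrib)
    qed
    ultimately show ?thesis
      by (simp add: sum_subtractf power_mult_distrib sum_distrib_left[symmetric] sum_divide_distrib[symmetric])
  qed
  show thesis
    by (rule that[OF q t hq G0 Gge]) (use fin in \<open>simp add: k1_def k2_def v_def\<close>)
qed

subsection \<open>The four sources\<close>

lemma bounded_at_top_of_limit: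
  fixes f :: "real \<Rightarrow> real"
  assumes "continuous_on {c..} f" and "(f \<longlongrightarrow> l) at_top"
  obtains C where "C > 0" "\<And>q. q \<ge> c \<Longrightarrow> f q \<le> C"
proof -
  obtain N where N: "\<And>q. q \<ge> N \<Longrightarrow> f q < l + 1"
    using order_tendstoD(2)[OF assms(2), of "l + 1"] by (auto simp: eventually_at_top_linorder)
  have "compact {c..max c N}" by simp
  moreover have "continuous_on {c..max c N} f" by (rule continuous_on_subset[OF assms(1)]) auto
  ultimately obtain M where M: "\<And>q. q \<in> {c..max c N} \<Longrightarrow> f q \<le> M"
    using continuous_attains_sup[of "{c..max c N}" f] by fastforce
  show thesis
  proof
    show "max 1 (max M (l + 1)) > 0" by simp
    show "f q \<le> max 1 (max M (l + 1))" if "q \<ge> c" for q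
      using M[of q] N[of q] that by (cases "q \<le> max c N") (auto simp: le_max_iff_disj)
  qed
qed

text \<open>Turns an asymptotic comparison at infinity into one on the whole ray from the gradient
  at the centre, the compact part being covered by continuity.\<close>

lemma ratio_bounded:
  fixes f g :: "real \<Rightarrow> real"
  assumes f: "continuous_on {c..} f" and g: "continuous_on {c..} g" and pos: "\<And>q. q \<ge> c \<Longrightarrow> g q > 0"
    and "((\<lambda>q. f q / g q) \<longlongrightarrow> l) at_top"
  obtains C where "C > 0" "\<And>q. q \<ge> c \<Longrightarrow> f q \<le> C * g q"
proof -
  have "continuous_on {c..} (\<lambda>q. f q / g q)"
    using pos by (intro continuous_on_divide f g) (auto simp: less_imp_neq[symmetric])
  from bounded_at_top_of_limit[OF this assms(4)] obtain C
    where "C > 0" "\<And>q. q \<ge> c \<Longrightarrow> f q / g q \<le> C" by metis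
  with pos show thesis by (intro that[of C]) (auto simp: divide_le_eq)
qed

text \<open>Gradient bounds from the source alone: as \<open>1/\<phi>\<^sup>m\<close> is at most the logarithm of the gradient at
  the maximum, the cutoff terms lose only a factor \<open>1/R\<close> against \<open>f\<^sup>2\<close>.\<close>

lemma no_gradient_of_superlogarithmic:
  fixes u :: "real^'n \<Rightarrow> real" and F F' :: "real \<Rightarrow> real" and m :: nat
  assumes sol: "entire_solution (\<lambda>p. F (norm p)) u"
    and F: "\<And>q. q > 0 \<Longrightarrow> (F has_real_derivative F' q) (at q)"
    and m: "m \<noteq> 0" and c: "c > 0" "\<And>q. q \<ge> norm (grad u a) \<Longrightarrow> c \<le> F q"
    and C: "\<And>q. q \<ge> norm (grad u a) \<Longrightarrow> (ln (1 + q\<^sup>2) / 2 + 4 ^ m) powr (1 + 1 / m) \<le> C * F q"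
    and D: "\<And>q. q \<ge> norm (grad u a) \<Longrightarrow> \<bar>q * F q / sqrt (1 + q\<^sup>2) + sqrt (1 + q\<^sup>2) * F' q\<bar> \<le> D * F q"
  shows "grad u a = 0"
proof (rule ccontr)
  assume "grad u a \<noteq> 0"
  define q0 where "q0 = norm (grad u a)"
  have q0: "q0 > 0" using \<open>grad u a \<noteq> 0\<close> by (simp add: q0_def)
  define n where "n = real CARD('n)"
  have n: "n > 0" by (simp add: n_def)
  \<comment> \<open>The final inequality of the proof reads \<open>R \<le> X\<close>. The sign of
    \<open>C\<close> and \<open>D\<close> is not known in advance, hence the absolute value in
    \<open>R\<close>.\<close>
  define X where "X = n * m * C * (n / c + D)"
  define R where "R = 1 + \<bar>X\<bar>"
  have R: "R \<ge> 1" "R > 0" "X < R" by (auto simp: R_def)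
  have start: "1 / (1/4 - 2 * 0) ^ m - 4 ^ m < ln (1 + (norm (grad u a))\<^sup>2) / 2"
    using \<open>grad u a \<noteq> 0\<close> by (simp add: power_one_over ln_gt_zero)
  obtain q t G where q: "q > 0" and t: "0 < t" "t \<le> 1/4"
    and tq: "ln (1 + q0\<^sup>2) / 2 - 1 / (1/4 - 2 * 0) ^ m + 1 / t ^ m \<le> ln (1 + q\<^sup>2) / 2"
    and G: "G \<ge> 0"
    and main: "(F q)\<^sup>2 / n + (m / t ^ (m + 1)) *
       (0 * (F q / sqrt (1 + q\<^sup>2) - q * sqrt (1 + q\<^sup>2) * F' q) - n / (2 * R\<^sup>2)
         - \<bar>q * F q / sqrt (1 + q\<^sup>2) + sqrt (1 + q\<^sup>2) * F' q\<bar> / (2 * R))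
      + ((m / t ^ (m + 1))\<^sup>2 - real m * real (m + 1) / t ^ (m + 2)) * G \<le> 0"
    using solution_max_principle[OF sol F R(2) m _ _ start, of 0] unfolding n_def q0_def
    by (metis abs_zero less_eq_real_def mult_zero_left zero_less_divide_1_iff zero_less_numeral)
  have t4: "4 ^ m \<le> 1 / t ^ m"
    using power_mono[of t "1/4" m] t by (simp add: field_simps power_one_over)
  then have "ln (1 + q0\<^sup>2) \<le> ln (1 + q\<^sup>2)"
    using tq by (simp add: power_one_over)
  then have "q0\<^sup>2 \<le> q\<^sup>2"
    by (subst (asm) ln_le_cancel_iff) (auto simp: add_pos_nonneg)
  then have qq: "q \<ge> norm (grad u a)"
    using power2_le_imp_le[of q0 q] q by (simp add: q0_def)
  define s where "s = 1 / t"
  have s: "s \<ge> 4" using t by (simp add: s_def field_simps)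
  have sm: "s ^ m \<le> ln (1 + q\<^sup>2) / 2 + 4 ^ m"
  proof -
    have "ln (1 + q0\<^sup>2) \<ge> 0" by simp
    moreover have "1 / (1/4 - 2 * 0) ^ m = (4::real) ^ m" by (simp add: power_one_over)
    moreover have "1 / t ^ m = s ^ m" by (simp add: s_def power_one_over)
    ultimately show ?thesis using tq by linarith
  qed
  \<comment> \<open>The factor in front of the cutoff terms is m s^(m+1), but the maximum controls
    s^m; this is the origin of the exponent 1 + 1/m.\<close>
  have "s ^ (m + 1) = (s ^ m) powr (1 + 1 / m)"
    using s m by (simp add: powr_powr powr_add flip: powr_realpow)
  also have "\<dots> \<le> (ln (1 + q\<^sup>2) / 2 + 4 ^ m) powr (1 + 1 / m)"
    using sm s by (intro powr_mono2) auto
  also have "\<dots> \<le> C * F q" by (rule C[OF qq])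
  finally have sC: "s ^ (m + 1) \<le> C * F q" .
  moreover have "0 \<le> s ^ (m + 1)" using s by simp
  ultimately have "0 \<le> C * F q" by linarith
  then have CF: "0 \<le> real m * (C * F q)" by simp
  have Fq: "F q \<ge> c" "F q > 0" using c(1) c(2)[OF qq] by auto
  have "(m / t ^ (m + 1))\<^sup>2 - real m * real (m + 1) / t ^ (m + 2) = m * s ^ (m + 2) * (m * s ^ m - (m + 1))"
  proof -
    have st: "x / t ^ k = x * s ^ k" for x and k by (simp add: s_def power_one_over)
    show ?thesis unfolding st by (simp add: algebra_simps power_add power2_eq_square)
  qed
  moreover have "m * s ^ m \<ge> m + 1"
  proof -
    have "s ^ 1 \<le> s ^ m" using s m by (intro power_increasing) auto
    then have "real m * 2 \<le> m * s ^ m" using s by (intro mult_left_mono) auto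
    moreover have "real m \<ge> 1" using m by simp
    ultimately show ?thesis by linarith
  qed
  ultimately have "((m / t ^ (m + 1))\<^sup>2 - real m * real (m + 1) / t ^ (m + 2)) * G \<ge> 0"
    using s G by (intro mult_nonneg_nonneg) auto
  then have "(F q)\<^sup>2 / n \<le> m * s ^ (m + 1) * (n / (2 * R\<^sup>2) +
      \<bar>q * F q / sqrt (1 + q\<^sup>2) + sqrt (1 + q\<^sup>2) * F' q\<bar> / (2 * R))"
    using main by (simp add: s_def power_one_over algebra_simps)
  also have "\<dots> \<le> m * (C * F q) * (n * (F q / c) / R + D * F q / R)"
  proof (intro mult_mono add_mono)
    \<comment> \<open>\<open>c \<le> F q\<close> lets the constant n be absorbed into a multiple of
      F, so that every term on the right becomes F^2 times a constant over R.\<close>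
    have "n * 1 \<le> n * (F q / c)" using Fq c n by (intro mult_left_mono) auto
    then have "n / R \<le> n * (F q / c) / R" using R by (intro divide_right_mono) auto
    moreover have "n / (2 * R\<^sup>2) \<le> n / R"
      using R n by (intro divide_left_mono) (auto simp: power2_eq_square)
    ultimately show "n / (2 * R\<^sup>2) \<le> n * (F q / c) / R" by linarith
    have "\<bar>q * F q / sqrt (1 + q\<^sup>2) + sqrt (1 + q\<^sup>2) * F' q\<bar> / (2 * R)
        \<le> \<bar>q * F q / sqrt (1 + q\<^sup>2) + sqrt (1 + q\<^sup>2) * F' q\<bar> / R"
      using R by (intro divide_left_mono) auto
    also have "\<dots> \<le> D * F q / R" using D[OF qq] R by (intro divide_right_mono) auto
    finally show "\<bar>q * F q / sqrt (1 + q\<^sup>2) + sqrt (1 + q\<^sup>2) * F' q\<bar> / (2 * R) \<le> D * F q / R" .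
  qed (use sC CF s n R in auto)
  also have "\<dots> = (F q)\<^sup>2 * (m * C * (n / c + D) / R)"
    using R c by (simp add: field_simps power2_eq_square)
  finally have "(F q)\<^sup>2 * (1 / n) \<le> (F q)\<^sup>2 * (m * C * (n / c + D) / R)" by simp
  then have "1 / n \<le> m * C * (n / c + D) / R"
    using Fq by (simp only: mult_le_cancel_left_pos zero_less_power)
  then show False
    using R n by (simp add: X_def field_simps)
qed

section \<open>Solutions of restricted growth: the barrier with m = 1 and a multiple of u\<close>

lemma small_of_smallo:
  fixes u :: "'a::euclidean_space \<Rightarrow> real"
  assumes u: "u \<in> o[at_infinity](\<lambda>x. norm x powr s)" and "s > 0" and cu: "continuous_on UNIV u" and "\<epsilon> > 0"
  shows "\<forall>\<^sub>F R in at_top. \<forall>y\<in>cball a R. \<bar>u y\<bar> \<le> \<epsilon> * R powr s"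
proof -
  \<comment> \<open>The ball is centred at \<open>a\<close>, not at the origin; for R at least |a|
    its points have norm at most 2 R, which costs the factor \<open>2 powr s\<close>. Points of norm
    below \<open>b\<close> are harmless because R^s exceeds any bound of u there.\<close>
  define \<delta> where "\<delta> = \<epsilon> / 2 powr s"
  have \<delta>: "\<delta> > 0" using assms by (simp add: \<delta>_def)
  obtain b where b: "\<And>y. norm y \<ge> b \<Longrightarrow> \<bar>u y\<bar> \<le> \<delta> * norm y powr s"
    using landau_o.smallD[OF u \<delta>] by (auto simp: eventually_at_infinity)
  obtain M where M: "\<And>y. y \<in> cball 0 b \<Longrightarrow> \<bar>u y\<bar> \<le> M"
  proof -
    have "bounded (u ` cball 0 b)"
      by (intro compact_imp_bounded compact_continuous_image continuous_on_subset[OF cu]) auto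
    then obtain M where "\<forall>x\<in>u ` cball 0 b. norm x \<le> M" unfolding bounded_iff by blast
    then show thesis by (intro that[of M]) auto
  qed
  have "\<forall>\<^sub>F R in at_top. M < \<epsilon> * R powr s"
  proof -
    have "filterlim (\<lambda>R. \<epsilon> * R powr s) at_top at_top"
      using assms by real_asymp
    then show ?thesis by (simp add: filterlim_at_top_dense)
  qed
  moreover have "\<forall>\<^sub>F R in at_top. norm a \<le> R" by (rule eventually_ge_at_top)
  ultimately show ?thesis
  proof eventually_elim
    case (elim R)
    show ?case
    proof
      fix y assume y: "y \<in> cball a R"
      show "\<bar>u y\<bar> \<le> \<epsilon> * R powr s"
      proof (cases "norm y \<ge> b")
        case True
        have "norm y \<le> 2 * R"
          using y elim norm_triangle_ineq[of a "y - a"] by (simp add: dist_norm norm_minus_commute)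
        then have "norm y powr s \<le> (2 * R) powr s" using \<open>s > 0\<close> by (intro powr_mono2) auto
        also have "\<dots> = 2 powr s * R powr s" by (simp add: powr_mult)
        finally have "\<delta> * norm y powr s \<le> \<delta> * (2 powr s * R powr s)" using \<delta> by (intro mult_left_mono) auto
        then show ?thesis using b[OF True] by (simp add: \<delta>_def)
      next
        case False
        then show ?thesis using M[of y] elim by simp
      qed
    qed
  qed
qed

lemma start_margin:
  assumes "(\<eta>::real) > 0"
  obtains \<epsilon> where "\<epsilon> > 0" "\<epsilon> < 1/8" "1 / (1/4 - 2 * \<epsilon>) - 4 < \<eta>"
proof -
  have "((\<lambda>\<epsilon>. 1 / (1/4 - 2 * \<epsilon>) - 4) \<longlongrightarrow> 1 / (1/4 - 2 * 0) - (4::real)) (at_right 0)"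
    by (intro tendsto_intros) auto
  then have "\<forall>\<^sub>F \<epsilon> in at_right 0. 1 / (1/4 - 2 * \<epsilon>) - 4 < \<eta>"
    by (rule order_tendstoD) (use assms in simp)
  moreover have "\<forall>\<^sub>F \<epsilon> in at_right (0::real). \<epsilon> \<in> {0<..<1/8}"
    by (rule eventually_at_right_real) simp
  ultimately have "\<forall>\<^sub>F \<epsilon> in at_right (0::real). \<epsilon> > 0 \<and> \<epsilon> < 1/8 \<and> 1 / (1/4 - 2 * \<epsilon>) - 4 < \<eta>"
    by eventually_elim auto
  then show thesis using that eventually_happens'[OF trivial_limit_at_right_real] by blast
qed

text \<open>With m = 1 and s = 1/t. The margin \<open>\<epsilon>\<close> is fixed by the gradient at
  \<open>a\<close> before R is chosen, so \<open>q0\<close> and \<open>A\<close> do not depend on R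
  and the limit in R can be taken.\<close>

lemma solution_max_principle_linear:
  fixes u :: "real^'n \<Rightarrow> real" and F F' :: "real \<Rightarrow> real" and \<mu> :: "real \<Rightarrow> real"
  assumes sol: "entire_solution (\<lambda>p. F (norm p)) u"
    and F: "\<And>q. q > 0 \<Longrightarrow> (F has_real_derivative F' q) (at q)"
    and \<mu>: "\<And>\<epsilon>. \<epsilon> > 0 \<Longrightarrow> \<forall>\<^sub>F R in at_top. \<forall>y\<in>cball a R. \<bar>\<mu> R * u y\<bar> \<le> \<epsilon>"
    and "grad u a \<noteq> 0"
  obtains q0 A where "q0 > 0" "A > 0" "\<forall>\<^sub>F R in at_top. \<exists>q s G. q \<ge> q0 \<and> s \<ge> 4 \<and> s \<le> ln (1 + q\<^sup>2) / 2 + A \<and>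
      G \<ge> 0 \<and> G \<ge> (\<mu> R)\<^sup>2 * (q\<^sup>2 / (1 + q\<^sup>2)) / 2 - 1 / (4 * R\<^sup>2) \<and>
      (F q)\<^sup>2 / CARD('n) + s\<^sup>2 *
       (\<mu> R * (F q / sqrt (1 + q\<^sup>2) - q * sqrt (1 + q\<^sup>2) * F' q) - CARD('n) / (2 * R\<^sup>2)
         - \<bar>q * F q / sqrt (1 + q\<^sup>2) + sqrt (1 + q\<^sup>2) * F' q\<bar> / (2 * R))
      + 8 * s\<^sup>2 * G \<le> 0"
proof -
  define h where "h = ln (1 + (norm (grad u a))\<^sup>2) / 2"
  have h: "h > 0" using \<open>grad u a \<noteq> 0\<close> by (simp add: h_def ln_gt_zero)
  obtain \<epsilon> where \<epsilon>: "\<epsilon> > 0" "\<epsilon> < 1/8" "1 / (1/4 - 2 * \<epsilon>) - 4 < h / 2"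
    using start_margin[of "h / 2"] h by auto
  define A where "A = 1 / (1/4 - 2 * \<epsilon>)"
  \<comment> \<open>\<open>h\<close> is ln v at \<open>a\<close>. The margin may consume half of it,
    so ln v at the maximum is still at least h / 2, that is 1 + q^2 >= exp h.\<close>
  define q0 where "q0 = sqrt (exp h - 1)"
  have A: "A > 0" using \<epsilon> by (simp add: A_def)
  show thesis
  proof (rule that[of q0 A])
    show "q0 > 0" using h by (simp add: q0_def)
    show "A > 0" by (rule A)
    show "\<forall>\<^sub>F R in at_top. \<exists>q s G. q \<ge> q0 \<and> s \<ge> 4 \<and> s \<le> ln (1 + q\<^sup>2) / 2 + A \<and>
      G \<ge> 0 \<and> G \<ge> (\<mu> R)\<^sup>2 * (q\<^sup>2 / (1 + q\<^sup>2)) / 2 - 1 / (4 * R\<^sup>2) \<and>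
      (F q)\<^sup>2 / CARD('n) + s\<^sup>2 *
       (\<mu> R * (F q / sqrt (1 + q\<^sup>2) - q * sqrt (1 + q\<^sup>2) * F' q) - CARD('n) / (2 * R\<^sup>2)
         - \<bar>q * F q / sqrt (1 + q\<^sup>2) + sqrt (1 + q\<^sup>2) * F' q\<bar> / (2 * R))
      + 8 * s\<^sup>2 * G \<le> 0"
      using \<mu>[OF \<epsilon>(1)] eventually_gt_at_top[of 0]
    proof eventually_elim
      case (elim R)
      have start: "1 / (1/4 - 2 * \<epsilon>) ^ 1 - 4 ^ 1 < ln (1 + (norm (grad u a))\<^sup>2) / 2"
        using \<epsilon>(3) h by (simp add: h_def)
      show ?case
      proof (rule solution_max_principle[OF sol F elim(2) one_neq_zero \<epsilon>(2) _ start, of "\<mu> R"])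
        show "\<bar>\<mu> R * u y\<bar> \<le> \<epsilon>" if "y \<in> cball a R" for y using elim that by blast
        fix q t G :: real
        assume q: "q > 0" and t: "0 < t" "t \<le> 1/4"
          and tq: "ln (1 + (norm (grad u a))\<^sup>2) / 2 - 1 / (1/4 - 2 * \<epsilon>) ^ 1 + 1 / t ^ 1 \<le> ln (1 + q\<^sup>2) / 2"
          and G: "G \<ge> 0" "G \<ge> (\<mu> R)\<^sup>2 * (q\<^sup>2 / (1 + q\<^sup>2)) / 2 - 1 / (4 * R\<^sup>2)"
          and main: "(F q)\<^sup>2 / CARD('n) + (real 1 / t ^ (1 + 1)) *
             (\<mu> R * (F q / sqrt (1 + q\<^sup>2) - q * sqrt (1 + q\<^sup>2) * F' q) - CARD('n) / (2 * R\<^sup>2)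
               - \<bar>q * F q / sqrt (1 + q\<^sup>2) + sqrt (1 + q\<^sup>2) * F' q\<bar> / (2 * R))
            + ((real 1 / t ^ (1 + 1))\<^sup>2 - real 1 * real (1 + 1) / t ^ (1 + 2)) * G \<le> 0"
        define s where "s = 1 / t"
        have s: "s \<ge> 4" using t by (simp add: s_def field_simps)
        have tq': "h - A + s \<le> ln (1 + q\<^sup>2) / 2" using tq by (simp add: h_def A_def s_def)
        have "A < 4 + h / 2" using \<epsilon>(3) by (simp add: A_def)
        then have "h \<le> ln (1 + q\<^sup>2)" using tq' s by linarith
        then have "exp h \<le> 1 + q\<^sup>2" by (simp add: ln_ge_iff add_pos_nonneg)
        then have "q0 \<le> q" using q unfolding q0_def by (intro real_le_lsqrt) auto
        \<comment> \<open>The coefficient of \<open>G\<close> is s^4 - 2 s^3 = s^2 * s (s - 2), and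
          s >= 4 gives s (s - 2) >= 8.\<close>
        have "s\<^sup>2 * 8 \<le> s\<^sup>2 * (s * (s - 2))"
          using mult_mono[of 4 s 2 "s - 2"] s by (intro mult_left_mono) auto
        then have "8 * s\<^sup>2 * G \<le> (s ^ 4 - 2 * s ^ 3) * G"
          using G(1) by (intro mult_right_mono) (auto simp: algebra_simps power2_eq_square power3_eq_cube power4_eq_xxxx)
        moreover have "(real 1 / t ^ (1 + 1))\<^sup>2 - real 1 * real (1 + 1) / t ^ (1 + 2) = s ^ 4 - 2 * s ^ 3"
          using t by (simp add: s_def power_one_over field_simps eval_nat_numeral)
        moreover have "real 1 / t ^ (1 + 1) = s\<^sup>2" by (simp add: s_def power2_eq_square)
        ultimately have "(F q)\<^sup>2 / CARD('n) + s\<^sup>2 *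
             (\<mu> R * (F q / sqrt (1 + q\<^sup>2) - q * sqrt (1 + q\<^sup>2) * F' q) - CARD('n) / (2 * R\<^sup>2)
               - \<bar>q * F q / sqrt (1 + q\<^sup>2) + sqrt (1 + q\<^sup>2) * F' q\<bar> / (2 * R)) + 8 * s\<^sup>2 * G \<le> 0"
          using main by (simp only:)
        moreover have "s \<le> ln (1 + q\<^sup>2) / 2 + A" using tq' h by linarith
        ultimately show ?case using s G \<open>q0 \<le> q\<close> by blast
      qed
    qed
  qed
qed

section \<open>The power source\<close>

lemma no_gradient_powr:
  fixes u :: "real^'n \<Rightarrow> real"
  assumes sol: "entire_solution (\<lambda>p. norm p powr \<theta>) u" and \<theta>: "\<theta> > 0"
  shows "grad u a = 0"
proof (rule ccontr)
  assume ne: "grad u a \<noteq> 0"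
  define q0 where "q0 = norm (grad u a)"
  have q0: "q0 > 0" using ne by (simp add: q0_def)
  have F: "((\<lambda>q. q powr \<theta>) has_real_derivative \<theta> * q powr (\<theta> - 1)) (at q)" if "q > 0" for q
    using that by (auto intro!: derivative_eq_intros)
  \<comment> \<open>m = 1 suffices: every positive power of q outgrows the square of the
    logarithm.\<close>
  have "((\<lambda>q. (ln (1 + q\<^sup>2) / 2 + 4 ^ 1) powr (1 + 1 / real 1) / q powr \<theta>) \<longlongrightarrow> 0) at_top"
    using \<theta> by simp real_asymp
  then obtain C where C: "\<And>q. q \<ge> q0 \<Longrightarrow> (ln (1 + q\<^sup>2) / 2 + 4 ^ 1) powr (1 + 1 / real 1) \<le> C * q powr \<theta>"
    by (rule ratio_bounded[rotated 3])
      (use q0 in \<open>auto intro!: continuous_intros simp: add_pos_nonneg less_imp_neq[symmetric] add_nonneg_pos[THEN less_imp_neq[symmetric]]\<close>)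
  have "((\<lambda>q. (q * q powr \<theta> / sqrt (1 + q\<^sup>2) + sqrt (1 + q\<^sup>2) * (\<theta> * q powr (\<theta> - 1))) / q powr \<theta>)
      \<longlongrightarrow> 1 + \<theta>) at_top"
    using \<theta> by real_asymp
  then obtain D where D: "\<And>q. q \<ge> q0 \<Longrightarrow>
      q * q powr \<theta> / sqrt (1 + q\<^sup>2) + sqrt (1 + q\<^sup>2) * (\<theta> * q powr (\<theta> - 1)) \<le> D * q powr \<theta>"
    by (rule ratio_bounded[rotated 3])
      (use q0 in \<open>auto intro!: continuous_intros simp: add_pos_nonneg less_imp_neq[symmetric]\<close>)
  have "grad u a = 0"
  proof (rule no_gradient_of_superlogarithmic[OF sol F one_neq_zero])
    show "q0 powr \<theta> > 0" using q0 by simp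
    fix q assume q: "norm (grad u a) \<le> q"
    then have q': "q \<ge> q0" by (simp add: q0_def)
    show "q0 powr \<theta> \<le> q powr \<theta>" using q' q0 \<theta> by (intro powr_mono2) auto
    show "(ln (1 + q\<^sup>2) / 2 + 4 ^ 1) powr (1 + 1 / real 1) \<le> C * q powr \<theta>" by (rule C[OF q'])
    have "q * q powr \<theta> / sqrt (1 + q\<^sup>2) + sqrt (1 + q\<^sup>2) * (\<theta> * q powr (\<theta> - 1)) \<ge> 0"
      using q' q0 \<theta> by (intro add_nonneg_nonneg divide_nonneg_nonneg mult_nonneg_nonneg) auto
    then show "\<bar>q * q powr \<theta> / sqrt (1 + q\<^sup>2) + sqrt (1 + q\<^sup>2) * (\<theta> * q powr (\<theta> - 1))\<bar> \<le> D * q powr \<theta>"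
      using D[OF q'] by simp
  qed
  with ne show False by simp
qed

section \<open>The logarithmic sources\<close>

lemma ln_one_plus_square_pos: "(q::real) > 0 \<Longrightarrow> ln (1 + q\<^sup>2) > 0"
  by (simp add: ln_gt_zero)

lemma continuous_on_ln_powr:
  assumes "(q0::real) > 0"
  shows "continuous_on {q0..} (\<lambda>q. ln (1 + q\<^sup>2) powr b)"
proof -
  have "1 + q\<^sup>2 \<noteq> 0" "1 + q\<^sup>2 \<noteq> 1" if "q \<ge> q0" for q :: real
    using that assms by (auto simp: add_nonneg_eq_0_iff)
  moreover have "1 + q\<^sup>2 > 0" for q :: real by (simp add: add_pos_nonneg)
  ultimately show ?thesis
    by (intro continuous_intros) (auto simp: ln_eq_zero_iff)
qed

context
  fixes \<theta> :: real
  assumes \<theta>: "\<theta> > 0"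
begin

lemma DERIV_ln_powr:
  assumes "q > 0"
  shows "((\<lambda>q. ln (1 + q\<^sup>2) powr \<theta>) has_real_derivative
    \<theta> * ln (1 + q\<^sup>2) powr (\<theta> - 1) * (2 * q / (1 + q\<^sup>2))) (at q)"
proof -
  have "1 + q\<^sup>2 > 0" "ln (1 + q\<^sup>2) > 0" using assms by (auto simp: add_pos_nonneg ln_one_plus_square_pos)
  moreover have "((\<lambda>q. ln (1 + q\<^sup>2)) has_real_derivative 2 * q / (1 + q\<^sup>2)) (at q)"
    using \<open>1 + q\<^sup>2 > 0\<close> by (auto intro!: derivative_eq_intros)
  ultimately show ?thesis
    using DERIV_fun_powr[of "\<lambda>q. ln (1 + q\<^sup>2)" "2 * q / (1 + q\<^sup>2)" q \<theta>] by simp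
qed

lemma ln_powr_flux_nonneg:
  assumes "q > 0"
  shows "q * ln (1 + q\<^sup>2) powr \<theta> / sqrt (1 + q\<^sup>2)
    + sqrt (1 + q\<^sup>2) * (\<theta> * ln (1 + q\<^sup>2) powr (\<theta> - 1) * (2 * q / (1 + q\<^sup>2))) \<ge> 0"
  using assms \<theta> by (intro add_nonneg_nonneg divide_nonneg_nonneg mult_nonneg_nonneg) auto

text \<open>The left-hand side is q F/v + v F', the size of the drift. Its first term is asymptotic
  to F, while v F' / F decays like the inverse of the logarithm.\<close>

lemma ln_powr_flux_bounded:
  assumes "(q0::real) > 0"
  obtains D where "D > 0" "\<And>q. q \<ge> q0 \<Longrightarrow> q * ln (1 + q\<^sup>2) powr \<theta> / sqrt (1 + q\<^sup>2)
    + sqrt (1 + q\<^sup>2) * (\<theta> * ln (1 + q\<^sup>2) powr (\<theta> - 1) * (2 * q / (1 + q\<^sup>2))) \<le> D * ln (1 + q\<^sup>2) powr \<theta>"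
proof -
  have nz: "1 + q\<^sup>2 \<noteq> 0" "sqrt (1 + q\<^sup>2) \<noteq> 0" for q :: real
    by (auto simp: add_nonneg_eq_0_iff)
  show thesis
  proof (rule ratio_bounded[OF _ continuous_on_ln_powr[OF assms] _ _ that])
    show "continuous_on {q0..} (\<lambda>q. q * ln (1 + q\<^sup>2) powr \<theta> / sqrt (1 + q\<^sup>2)
      + sqrt (1 + q\<^sup>2) * (\<theta> * ln (1 + q\<^sup>2) powr (\<theta> - 1) * (2 * q / (1 + q\<^sup>2))))"
      by (intro continuous_on_add continuous_on_mult continuous_on_divide continuous_on_ln_powr assms
          continuous_on_const continuous_on_id continuous_on_real_sqrt continuous_on_power ballI nz)
    show "ln (1 + q\<^sup>2) powr \<theta> > 0" if "q \<ge> q0" for q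
      using ln_one_plus_square_pos[of q] that assms by simp
    show "((\<lambda>q. (q * ln (1 + q\<^sup>2) powr \<theta> / sqrt (1 + q\<^sup>2)
      + sqrt (1 + q\<^sup>2) * (\<theta> * ln (1 + q\<^sup>2) powr (\<theta> - 1) * (2 * q / (1 + q\<^sup>2)))) / ln (1 + q\<^sup>2) powr \<theta>)
        \<longlongrightarrow> 1) at_top"
      using \<theta> by real_asymp
  qed
qed

lemma no_gradient_ln_powr_superlinear:
  fixes u :: "real^'n \<Rightarrow> real"
  assumes sol: "entire_solution (\<lambda>p. ln (1 + (norm p)\<^sup>2) powr \<theta>) u" and "\<theta> > 1"
  shows "grad u a = 0"
proof (rule ccontr)
  assume ne: "grad u a \<noteq> 0"
  define q0 where "q0 = norm (grad u a)"
  have q0: "q0 > 0" using ne by (simp add: q0_def)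
  \<comment> \<open>The excess of \<open>\<theta>\<close> over 1 leaves room for 1 + 1/m <
    \<open>\<theta>\<close>, so that the logarithm to the power 1 + 1/m is negligible against
    F.\<close>
  obtain m :: nat where m: "m \<noteq> 0" "inverse (real m) < \<theta> - 1"
    using real_arch_inverse[of "\<theta> - 1"] \<open>\<theta> > 1\<close> by auto
  define b where "b = 1 + 1 / real m"
  define k :: real where "k = 4 ^ m"
  have b: "b > 0" "b < \<theta>" and k: "k > 0" using m by (auto simp: b_def k_def inverse_eq_divide add_pos_nonneg)
  have pos: "ln (1 + q\<^sup>2) powr \<theta> > 0" if "q \<ge> q0" for q
    using that q0 ln_one_plus_square_pos[of q] by simp
  have lim: "((\<lambda>q. (ln (1 + q\<^sup>2) / 2 + k) powr b / ln (1 + q\<^sup>2) powr \<theta>) \<longlongrightarrow> 0) at_top"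
    using b k by real_asymp
  have cont: "continuous_on {q0..} (\<lambda>q. (ln (1 + q\<^sup>2) / 2 + k) powr b)"
  proof -
    have "1 + q\<^sup>2 > 0" "1 + q\<^sup>2 \<noteq> 0" "ln (1 + q\<^sup>2) / 2 + k \<noteq> 0" for q :: real
      using k ln_ge_zero[of "1 + q\<^sup>2"] by (auto simp: add_pos_nonneg add_nonneg_eq_0_iff)
    then show ?thesis by (intro continuous_intros) auto
  qed
  obtain C where "C > 0" and C: "\<And>q. q \<ge> q0 \<Longrightarrow> (ln (1 + q\<^sup>2) / 2 + k) powr b \<le> C * ln (1 + q\<^sup>2) powr \<theta>"
    by (rule ratio_bounded[OF cont continuous_on_ln_powr[OF q0] pos lim]) (assumption, rule that)
  obtain D where "D > 0" and D: "\<And>q. q \<ge> q0 \<Longrightarrow> q * ln (1 + q\<^sup>2) powr \<theta> / sqrt (1 + q\<^sup>2)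
    + sqrt (1 + q\<^sup>2) * (\<theta> * ln (1 + q\<^sup>2) powr (\<theta> - 1) * (2 * q / (1 + q\<^sup>2))) \<le> D * ln (1 + q\<^sup>2) powr \<theta>"
    by (rule ln_powr_flux_bounded[OF q0]) (rule that)
  have "grad u a = 0"
  proof (rule no_gradient_of_superlogarithmic[OF sol DERIV_ln_powr m(1)])
    show "ln (1 + q0\<^sup>2) powr \<theta> > 0" by (rule pos) simp
    fix q assume "norm (grad u a) \<le> q"
    then have q: "q \<ge> q0" by (simp add: q0_def)
    show "ln (1 + q0\<^sup>2) powr \<theta> \<le> ln (1 + q\<^sup>2) powr \<theta>"
      using q q0 \<theta> by (intro powr_mono2 ln_mono) (auto simp: add_pos_nonneg)
    show "(ln (1 + q\<^sup>2) / 2 + 4 ^ m) powr (1 + 1 / real m) \<le> C * ln (1 + q\<^sup>2) powr \<theta>"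
      using C[OF q] by (simp add: b_def k_def)
    show "\<bar>q * ln (1 + q\<^sup>2) powr \<theta> / sqrt (1 + q\<^sup>2)
      + sqrt (1 + q\<^sup>2) * (\<theta> * ln (1 + q\<^sup>2) powr (\<theta> - 1) * (2 * q / (1 + q\<^sup>2)))\<bar> \<le> D * ln (1 + q\<^sup>2) powr \<theta>"
      using D[OF q] ln_powr_flux_nonneg[of q] q q0 by simp
  qed
  with ne show False by simp
qed

text \<open>The source alone no longer beats the cutoff, since s^2 F / R may exceed F^2 when q is
  huge. The barrier term -u / R^2 is favourable there: -L u contains q v F', which has order q up to
  logarithms. It forces q to be at most of order R up to logarithms, and then s is logarithmic in R,
  too small for R = O(s^2).\<close>

lemma no_gradient_ln_powr_subquadratic:
  fixes u :: "real^'n \<Rightarrow> real"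
  assumes sol: "entire_solution (\<lambda>p. ln (1 + (norm p)\<^sup>2) powr \<theta>) u"
    and u: "u \<in> o[at_infinity](\<lambda>x. (norm x)\<^sup>2)" and cu: "continuous_on UNIV u"
  shows "grad u a = 0"
proof (rule ccontr)
  assume ne: "grad u a \<noteq> 0"
  define F where "F = (\<lambda>q. ln (1 + q\<^sup>2) powr \<theta>)"
  define F' where "F' = (\<lambda>q. \<theta> * ln (1 + q\<^sup>2) powr (\<theta> - 1) * (2 * q / (1 + q\<^sup>2)))"
  define n where "n = real CARD('n)"
  have n: "n > 0" by (simp add: n_def)
  have sol': "entire_solution (\<lambda>p. F (norm p)) u" using sol by (simp add: F_def)
  have F: "(F has_real_derivative F' q) (at q)" if "q > 0" for q
    using DERIV_ln_powr[OF that] by (simp add: F_def F'_def)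
  have u': "u \<in> o[at_infinity](\<lambda>x. norm x powr 2)"
    using u by (simp add: powr_numeral)
  have \<mu>: "\<forall>\<^sub>F R in at_top. \<forall>y\<in>cball a R. \<bar>- (1 / R\<^sup>2) * u y\<bar> \<le> \<epsilon>" if "\<epsilon> > 0" for \<epsilon>
    using small_of_smallo[OF u' zero_less_numeral cu that, of a] eventually_gt_at_top[of 0]
    by eventually_elim (simp add: abs_mult divide_le_eq powr_numeral)
  obtain q0 A where q0: "q0 > 0" and A: "A > 0" and ev: "\<forall>\<^sub>F R in at_top. \<exists>q s G. q \<ge> q0 \<and> s \<ge> 4 \<and> s \<le> ln (1 + q\<^sup>2) / 2 + A \<and>
      G \<ge> 0 \<and> G \<ge> (- (1 / R\<^sup>2))\<^sup>2 * (q\<^sup>2 / (1 + q\<^sup>2)) / 2 - 1 / (4 * R\<^sup>2) \<and>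
      (F q)\<^sup>2 / n + s\<^sup>2 *
       (- (1 / R\<^sup>2) * (F q / sqrt (1 + q\<^sup>2) - q * sqrt (1 + q\<^sup>2) * F' q) - n / (2 * R\<^sup>2)
         - \<bar>q * F q / sqrt (1 + q\<^sup>2) + sqrt (1 + q\<^sup>2) * F' q\<bar> / (2 * R))
      + 8 * s\<^sup>2 * G \<le> 0"
    using solution_max_principle_linear[OF sol' F \<mu> ne] unfolding n_def by blast
  obtain D where D: "D > 0" "\<And>q. q \<ge> q0 \<Longrightarrow> q * F q / sqrt (1 + q\<^sup>2) + sqrt (1 + q\<^sup>2) * F' q \<le> D * F q"
    by (rule ln_powr_flux_bounded[OF q0]) (rule that, assumption, unfold F_def F'_def, blast)
  \<comment> \<open>The favourable part of -L u = q v F' - F/v; the other part is bounded by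
    F.\<close>
  define W where "W = (\<lambda>q. q * sqrt (1 + q\<^sup>2) * F' q)"
  have W: "W q > 0" if "q \<ge> q0" for q
    using that q0 \<theta> ln_one_plus_square_pos[of q] unfolding W_def F'_def
    by (intro mult_pos_pos divide_pos_pos) (auto simp: add_pos_nonneg)
  \<comment> \<open>The fourth power anticipates that R = O(s^2) is squared below. \<open>W\<close>
    grows like q up to logarithms and so dominates any power of the logarithm times F.\<close>
  obtain C where C: "C > 0" "\<And>q. q \<ge> q0 \<Longrightarrow> (ln (1 + q\<^sup>2) / 2 + A) ^ 4 * F q \<le> C * W q"
  proof -
    have nz: "1 + q\<^sup>2 \<noteq> 0" "1 + q\<^sup>2 > 0" for q :: real
      by (auto simp: add_pos_nonneg add_nonneg_eq_0_iff)
    have c1: "continuous_on {q0..} (\<lambda>q. (ln (1 + q\<^sup>2) / 2 + A) ^ 4 * F q)"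
      unfolding F_def
      by (intro continuous_on_add continuous_on_mult continuous_on_divide continuous_on_ln_powr q0
          continuous_on_const continuous_on_id continuous_on_ln continuous_on_power ballI nz(1)) auto
    have c2: "continuous_on {q0..} W"
      unfolding W_def F'_def
      by (intro continuous_on_add continuous_on_mult continuous_on_divide continuous_on_ln_powr q0
          continuous_on_const continuous_on_id continuous_on_real_sqrt continuous_on_power ballI
          nz(1))
    have "((\<lambda>q. (ln (1 + q\<^sup>2) / 2 + A) ^ 4 * F q / W q) \<longlongrightarrow> 0) at_top"
      unfolding W_def F_def F'_def using A \<theta> by real_asymp
    from ratio_bounded[OF c1 c2 W this that] show thesis .
  qed
  define c where "c = F q0"
  have c: "c > 0" using q0 ln_one_plus_square_pos[of q0] by (simp add: c_def F_def)
  have Fc: "F q \<ge> c" if "q \<ge> q0" for q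
    unfolding F_def c_def using that q0 \<theta> by (intro powr_mono2 ln_mono) (auto simp: add_pos_nonneg)
  \<comment> \<open>One summand for each unfavourable term, all of them bounded by multiples of F /
    R: the 1 for F/v, then the trace of the cutoff, then its drift.\<close>
  define K where "K = 1 + n / c + D"
  define N where "N = (n * K / c)\<^sup>2"
  define M where "M = N * C * K"
  have K: "K > 0" using n c D by (simp add: K_def add_pos_pos)
  obtain R where R: "R \<ge> 1" "R > M" and "\<exists>q s G. q \<ge> q0 \<and> s \<ge> 4 \<and> s \<le> ln (1 + q\<^sup>2) / 2 + A \<and>
      G \<ge> 0 \<and> G \<ge> (- (1 / R\<^sup>2))\<^sup>2 * (q\<^sup>2 / (1 + q\<^sup>2)) / 2 - 1 / (4 * R\<^sup>2) \<and>
      (F q)\<^sup>2 / n + s\<^sup>2 *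
       (- (1 / R\<^sup>2) * (F q / sqrt (1 + q\<^sup>2) - q * sqrt (1 + q\<^sup>2) * F' q) - n / (2 * R\<^sup>2)
         - \<bar>q * F q / sqrt (1 + q\<^sup>2) + sqrt (1 + q\<^sup>2) * F' q\<bar> / (2 * R))
      + 8 * s\<^sup>2 * G \<le> 0"
    using eventually_happens'[OF trivial_limit_at_top_linorder
        eventually_conj[OF eventually_ge_at_top[of 1] eventually_conj[OF eventually_gt_at_top[of M] ev]]]
    by blast
  then obtain q s G where q: "q \<ge> q0" and s: "s \<ge> 4" "s \<le> ln (1 + q\<^sup>2) / 2 + A" and G: "G \<ge> 0"
    and main: "(F q)\<^sup>2 / n + s\<^sup>2 *
       (- (1 / R\<^sup>2) * (F q / sqrt (1 + q\<^sup>2) - q * sqrt (1 + q\<^sup>2) * F' q) - n / (2 * R\<^sup>2)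
         - \<bar>q * F q / sqrt (1 + q\<^sup>2) + sqrt (1 + q\<^sup>2) * F' q\<bar> / (2 * R))
      + 8 * s\<^sup>2 * G \<le> 0" by blast
  define X where "X = - (1 / R\<^sup>2) * (F q / sqrt (1 + q\<^sup>2) - q * sqrt (1 + q\<^sup>2) * F' q) - n / (2 * R\<^sup>2)
         - \<bar>q * F q / sqrt (1 + q\<^sup>2) + sqrt (1 + q\<^sup>2) * F' q\<bar> / (2 * R)"
  have Fq: "F q \<ge> c" "F q > 0" using Fc[OF q] c by auto
  have RR: "R \<le> R\<^sup>2" "R > 0" using R by (auto simp: power2_eq_square)
  have X: "X \<ge> W q / R\<^sup>2 - K * F q / R"
  proof -
    have "F q / sqrt (1 + q\<^sup>2) \<le> F q / 1"
      using Fq by (intro divide_left_mono) (auto simp: add_pos_nonneg)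
    then have "F q / sqrt (1 + q\<^sup>2) / R\<^sup>2 \<le> F q / R"
      using RR Fq by (intro frac_le) auto
    moreover have "n / (2 * R\<^sup>2) \<le> (n / c * F q) / R"
    proof (rule frac_le)
      have "n / c * c \<le> n / c * F q" using Fq n c by (intro mult_left_mono) auto
      then show "n \<le> n / c * F q" using c by simp
    qed (use RR n c Fq in auto)
    moreover have "\<bar>q * F q / sqrt (1 + q\<^sup>2) + sqrt (1 + q\<^sup>2) * F' q\<bar> / (2 * R) \<le> D * F q / R"
    proof (rule frac_le)
      show "\<bar>q * F q / sqrt (1 + q\<^sup>2) + sqrt (1 + q\<^sup>2) * F' q\<bar> \<le> D * F q"
        using D(2)[OF q] ln_powr_flux_nonneg[of q] q q0 by (simp add: F_def F'_def)
    qed (use RR D Fq in auto)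
    moreover have "K * F q / R = F q / R + (n / c * F q) / R + D * F q / R"
      by (simp add: K_def distrib_right add_divide_distrib)
    moreover have "- (1 / R\<^sup>2) * (F q / sqrt (1 + q\<^sup>2) - q * sqrt (1 + q\<^sup>2) * F' q)
        = W q / R\<^sup>2 - F q / sqrt (1 + q\<^sup>2) / R\<^sup>2"
      by (simp add: W_def diff_divide_distrib)
    ultimately show ?thesis unfolding X_def by linarith
  qed
  have "s\<^sup>2 * X \<le> - ((F q)\<^sup>2 / n)"
    using main s G unfolding X_def[symmetric] by (smt (verit) mult_nonneg_nonneg zero_le_power2)
  then have sX: "s\<^sup>2 * (- X) \<ge> (F q)\<^sup>2 / n" by simp
  then have "s\<^sup>2 * (- X) > 0" using Fq n by (smt (verit) divide_pos_pos zero_less_power)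
  then have "X < 0" using s by (simp add: mult_less_0_iff)
  then have "W q / R\<^sup>2 < K * F q / R" using X by linarith
  \<comment> \<open>Negativity of the bracket bounds q in terms of R. Discarding \<open>W\<close> in
    the same bracket gives R = O(s^2) below, and the two bounds together yield
    \<open>R \<le> M\<close>.\<close>
  then have WK: "W q \<le> K * R * F q" using RR by (simp add: field_simps power2_eq_square)
  have "- X \<le> K * F q / R" using X W[OF q] RR by (smt (verit) divide_pos_pos zero_less_power)
  then have "s\<^sup>2 * (- X) \<le> s\<^sup>2 * (K * F q / R)" by (intro mult_left_mono) auto
  then have "(F q)\<^sup>2 / n \<le> s\<^sup>2 * (K * F q / R)" using sX by linarith
  then have "F q * (F q * R) \<le> F q * (n * K * s\<^sup>2)" using RR n by (simp add: field_simps power2_eq_square)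
  then have "F q * R \<le> n * K * s\<^sup>2" using Fq by simp
  moreover have "c * R \<le> F q * R" using Fq RR by (intro mult_right_mono) auto
  ultimately have "c * R \<le> n * K * s\<^sup>2" by linarith
  then have "R \<le> n * K / c * s\<^sup>2" using c by (simp add: field_simps)
  then have "R\<^sup>2 \<le> (n * K / c * s\<^sup>2)\<^sup>2" using RR by (intro power_mono) auto
  also have "\<dots> = N * s ^ 4"
    by (simp add: N_def power_mult_distrib power_divide power_mult[symmetric])
  finally have "R\<^sup>2 * F q \<le> N * s ^ 4 * F q"
    using Fq by (intro mult_right_mono) auto
  moreover have "N * (s ^ 4 * F q) \<le> N * (C * (K * R * F q))"
  proof (rule mult_left_mono)
    have "s ^ 4 * F q \<le> (ln (1 + q\<^sup>2) / 2 + A) ^ 4 * F q"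
      using s Fq by (intro mult_right_mono power_mono) auto
    also have "\<dots> \<le> C * W q" by (rule C(2)[OF q])
    also have "\<dots> \<le> C * (K * R * F q)" using C WK by (intro mult_left_mono) auto
    finally show "s ^ 4 * F q \<le> C * (K * R * F q)" .
  qed (simp add: N_def)
  ultimately have "R * (R * F q) \<le> M * (R * F q)"
    by (simp add: M_def power2_eq_square mult_ac)
  then show False
    using R RR Fq by simp
qed

end

section \<open>The bounded source\<close>

text \<open>As F stays bounded, F^2 cannot absorb cutoff terms of size s^2 / R with s unbounded. The
  term 8 s^2 G carries the same factor s^2 and takes over: after cancelling s^2 the comparison is
  between R^(-2/3) and 1/R, uniformly in q.\<close>

lemma no_gradient_bounded_source:
  fixes u :: "real^'n \<Rightarrow> real"
  assumes sol: "entire_solution (\<lambda>p. norm p / sqrt (1 + (norm p)\<^sup>2)) u"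
    and u: "u \<in> o[at_infinity](\<lambda>x. norm x powr (1/3))" and cu: "continuous_on UNIV u"
  shows "grad u a = 0"
proof (rule ccontr)
  assume ne: "grad u a \<noteq> 0"
  define F where "F = (\<lambda>q::real. q / sqrt (1 + q\<^sup>2))"
  define F' where "F' = (\<lambda>q::real. 1 / ((1 + q\<^sup>2) * sqrt (1 + q\<^sup>2)))"
  define n where "n = real CARD('n)"
  have n: "n > 0" by (simp add: n_def)
  have sol': "entire_solution (\<lambda>p. F (norm p)) u" using sol by (simp add: F_def)
  have v: "sqrt (1 + q\<^sup>2) > 0" "1 + q\<^sup>2 > 0" "sqrt (1 + q\<^sup>2) * sqrt (1 + q\<^sup>2) = 1 + q\<^sup>2" for q :: real
    by (auto simp: add_pos_nonneg)
  have F: "(F has_real_derivative F' q) (at q)" for q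
  proof -
    have "((\<lambda>q. sqrt (1 + q\<^sup>2)) has_real_derivative q / sqrt (1 + q\<^sup>2)) (at q)"
      using v(2)[of q] by (auto intro!: derivative_eq_intros simp: field_simps)
    from DERIV_divide[OF DERIV_ident this] v(1)[of q]
    have "(F has_real_derivative (1 * sqrt (1 + q\<^sup>2) - q * (q / sqrt (1 + q\<^sup>2))) / (sqrt (1 + q\<^sup>2) * sqrt (1 + q\<^sup>2))) (at q)"
      unfolding F_def by simp
    moreover have "(1 * w - q * (q / w)) / (w * w) = 1 / ((1 + q\<^sup>2) * w)" if "w > 0" "w * w = 1 + q\<^sup>2" for w
    proof -
      have "1 * w - q * (q / w) = (w * w - q\<^sup>2) / w" using that(1) by (simp add: field_simps power2_eq_square)
      then show ?thesis using that by simp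
    qed
    ultimately show ?thesis using v[of q] by (simp only: F'_def)
  qed
  have third: "(0::real) < 1/3" by simp
  have \<mu>: "\<forall>\<^sub>F R in at_top. \<forall>y\<in>cball a R. \<bar>R powr (- (1/3)) * u y\<bar> \<le> \<epsilon>" if "\<epsilon> > 0" for \<epsilon>
    using small_of_smallo[OF u third cu that, of a] eventually_gt_at_top[of 0]
    by eventually_elim (simp add: abs_mult powr_minus field_simps)
  obtain q0 A where q0: "q0 > 0" and ev: "\<forall>\<^sub>F R in at_top. \<exists>q s G. q \<ge> q0 \<and> s \<ge> 4 \<and> s \<le> ln (1 + q\<^sup>2) / 2 + A \<and>
      G \<ge> 0 \<and> G \<ge> (R powr (- (1/3)))\<^sup>2 * (q\<^sup>2 / (1 + q\<^sup>2)) / 2 - 1 / (4 * R\<^sup>2) \<and>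
      (F q)\<^sup>2 / n + s\<^sup>2 *
       (R powr (- (1/3)) * (F q / sqrt (1 + q\<^sup>2) - q * sqrt (1 + q\<^sup>2) * F' q) - n / (2 * R\<^sup>2)
         - \<bar>q * F q / sqrt (1 + q\<^sup>2) + sqrt (1 + q\<^sup>2) * F' q\<bar> / (2 * R))
      + 8 * s\<^sup>2 * G \<le> 0"
    using solution_max_principle_linear[OF sol' F \<mu> ne] unfolding n_def by blast
  \<comment> \<open>A lower bound of q^2 / (1 + q^2) that does not depend on R, since this quotient
    increases with q.\<close>
  define d where "d = q0\<^sup>2 / (1 + q0\<^sup>2)"
  have d: "d > 0" using q0 by (simp add: d_def add_pos_nonneg)
  have "\<forall>\<^sub>F R in at_top. 4 * ((R powr (- (1/3)))\<^sup>2 * d) > 2 / R\<^sup>2 + n / (2 * R\<^sup>2) + 1 / (2 * R)"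
    using d n by real_asymp
  from eventually_happens'[OF trivial_limit_at_top_linorder eventually_conj[OF this ev]]
  obtain R q s G where R: "4 * ((R powr (- (1/3)))\<^sup>2 * d) > 2 / R\<^sup>2 + n / (2 * R\<^sup>2) + 1 / (2 * R)"
    and q: "q \<ge> q0" and s: "s \<ge> 4"
    and G: "G \<ge> (R powr (- (1/3)))\<^sup>2 * (q\<^sup>2 / (1 + q\<^sup>2)) / 2 - 1 / (4 * R\<^sup>2)"
    and main: "(F q)\<^sup>2 / n + s\<^sup>2 *
       (R powr (- (1/3)) * (F q / sqrt (1 + q\<^sup>2) - q * sqrt (1 + q\<^sup>2) * F' q) - n / (2 * R\<^sup>2)
         - \<bar>q * F q / sqrt (1 + q\<^sup>2) + sqrt (1 + q\<^sup>2) * F' q\<bar> / (2 * R))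
      + 8 * s\<^sup>2 * G \<le> 0" by blast
  \<comment> \<open>Here F = q/v and F' = 1/v^3, so L u = q/v^2 - q/v^2. The multiple of u in the
    barrier thus costs nothing, and the drift q F/v + v F' is exactly 1.\<close>
  have z: "F q / sqrt (1 + q\<^sup>2) - q * sqrt (1 + q\<^sup>2) * F' q = 0"
    using v[of q] by (simp add: F_def F'_def)
  have o: "q * F q / sqrt (1 + q\<^sup>2) + sqrt (1 + q\<^sup>2) * F' q = 1"
  proof -
    have "q * F q / sqrt (1 + q\<^sup>2) = q\<^sup>2 / (1 + q\<^sup>2)" using v(3)[of q] by (simp add: F_def power2_eq_square)
    moreover have "sqrt (1 + q\<^sup>2) * F' q = 1 / (1 + q\<^sup>2)" using v(1)[of q] by (simp add: F'_def)
    ultimately show ?thesis using v(2)[of q] by (simp add: add_divide_distrib[symmetric])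
  qed
  have "s\<^sup>2 * (8 * G - (n / (2 * R\<^sup>2) + 1 / (2 * R))) \<le> - ((F q)\<^sup>2 / n)"
    using main unfolding z o by (simp add: algebra_simps)
  also have "\<dots> \<le> 0" using n by simp
  finally have "8 * G \<le> n / (2 * R\<^sup>2) + 1 / (2 * R)"
    using s by (simp add: mult_le_0_iff)
  moreover have "d \<le> q\<^sup>2 / (1 + q\<^sup>2)"
  proof -
    have "q0\<^sup>2 \<le> q\<^sup>2" using q q0 by (intro power_mono) auto
    then show ?thesis using v(2)[of q] v(2)[of q0] by (simp add: d_def divide_simps algebra_simps)
  qed
  then have "(R powr (- (1/3)))\<^sup>2 * d \<le> (R powr (- (1/3)))\<^sup>2 * (q\<^sup>2 / (1 + q\<^sup>2))"
    by (intro mult_left_mono) auto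
  moreover define Y where "Y = (R powr (- (1/3)))\<^sup>2 * (q\<^sup>2 / (1 + q\<^sup>2))"
  moreover have "2 / R\<^sup>2 = 8 * (1 / (4 * R\<^sup>2))" by simp
  ultimately show False
    using R G unfolding Y_def[symmetric] by linarith
qed

theorem mainTheorem2:
  fixes u f :: "real^'n \<Rightarrow> real"
  assumes "entire_solution f u"
    and "(\<exists>\<theta>>0. f = (\<lambda>p. norm p powr \<theta>))
       \<or> (\<exists>\<theta>>1. f = (\<lambda>p. ln (1 + (norm p)\<^sup>2) powr \<theta>))
       \<or> (\<exists>\<theta>. 0 < \<theta> \<and> \<theta> \<le> 1 \<and> f = (\<lambda>p. ln (1 + (norm p)\<^sup>2) powr \<theta>)
            \<and> u \<in> o[at_infinity](\<lambda>x. (norm x)\<^sup>2))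
       \<or> (f = (\<lambda>p. norm p / sqrt (1 + (norm p)\<^sup>2))
            \<and> u \<in> o[at_infinity](\<lambda>x. norm x powr (1/3)))"
  shows "u constant_on UNIV"
proof -
  have du: "(u has_derivative (\<lambda>\<xi>. grad u y \<bullet> \<xi>)) (at y)" for y
    using assms(1) by (intro has_derivative_grad) (simp add: entire_solution_def)
  have cu: "continuous_on UNIV u"
    by (intro continuous_at_imp_continuous_on ballI has_derivative_continuous[OF du])
  have "grad u a = 0" for a
    using assms(2)
  proof (elim disjE exE conjE)
    fix \<theta> :: real assume "\<theta> > 0" "f = (\<lambda>p. norm p powr \<theta>)"
    then show ?thesis using no_gradient_powr assms(1) by blast
  next
    fix \<theta> :: real assume "\<theta> > 1" "f = (\<lambda>p. ln (1 + (norm p)\<^sup>2) powr \<theta>)"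
    then show ?thesis using no_gradient_ln_powr_superlinear[of \<theta> u a] assms(1) by simp
  next
    fix \<theta> :: real
    assume "0 < \<theta>" "f = (\<lambda>p. ln (1 + (norm p)\<^sup>2) powr \<theta>)" "u \<in> o[at_infinity](\<lambda>x. (norm x)\<^sup>2)"
    then show ?thesis using no_gradient_ln_powr_subquadratic[of \<theta> u a] cu assms(1) by simp
  next
    assume "f = (\<lambda>p. norm p / sqrt (1 + (norm p)\<^sup>2))" "u \<in> o[at_infinity](\<lambda>x. norm x powr (1/3))"
    then show ?thesis using no_gradient_bounded_source[of u a] cu assms(1) by simp
  qed
  then have "(u has_derivative (\<lambda>\<xi>. 0)) (at y within UNIV)" for y
    using du[of y] by simp
  then show ?thesis
    using has_derivative_zero_constant[OF convex_UNIV, of u] unfolding constant_on_def by blast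
qed

end
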